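(* Let $n\ge1$, let $q\in F^*$ be a root of unity of order $N\ge2$, and let $V$ be of Cartan type $A_n$: $q_{ii}=q$ for all $i$, $q_{i,i+1}q_{i+1,i}=q^{-1}$ for $1\le i<n$, and $q_{ij}q_{ji}=1$ for $|i-j|\ge2$. Then $$\dim\mathfrak{L}(V)=N^{\binom{n+1}{2}}-1+\sum_{j=1}^{\lfloor (n-1)/2\rfloor}(-1)^j\sum_{n_1=1}^{n-2}\sum_{n_2=1}^{n_1-2}\cdots\sum_{n_j=1}^{n_{j-1}-2}\Big(N^{\binom{n_j+1}{2}}-1\Big)\prod_{i=1}^{j}\Big(N^{\binom{n_{i-1}-n_i}{2}}-N^{\binom{n_{i-1}-n_i-1}{2}}\Big),$$ where $n_0:=n$, $\binom{k}{2}=k(k-1)/2$ (so $\binom{0}{2}=\binom12=0$), and empty sums are $0$.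
   Context: $F$ is an algebraically closed field of characteristic $0$. $V$ is a braided vector space of diagonal type with basis $x_1,\dots,x_n$ and braiding $C(x_i\otimes x_j)=q_{ij}x_j\otimes x_i$; $\mathfrak{B}(V)$ is its Nichols algebra, $\mathbb{Z}^n$-graded with $\deg x_i=e_i$, $\chi(e_i,e_j)=q_{ij}$ and $p_{uv}:=\chi(\deg u,\deg v)$ for homogeneous $u,v$. For homogeneous $x,y$, $[x,y]:=yx-p_{yx}xy$, and the Nichols braided Lie algebra $\mathfrak{L}(V)$ is the linear span in $\mathfrak{B}(V)$ of all iterated brackets (any bracketing) of $x_1,\dots,x_n$. *)

theory Defs
  imports Main "HOL-Library.Function_Algebras" "HOL-Computational_Algebra.Polynomial"
begin

text \<open>The braiding matrix is qm :: nat => nat => 'a, indices 1..n; qm i j = q_ij.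
  Elements of the (completed) tensor coalgebra T^c(V) are functions
  nat list => 'a (coefficient of each word). The quantum shuffle product realises
  the multiplication of the Nichols algebra: B(V) is the subalgebra generated by
  the letters x_i = [i] (Rosso / Schauenburg).\<close>

definition shuf_coeff :: "(nat \<Rightarrow> nat \<Rightarrow> 'a::comm_ring_1) \<Rightarrow> nat list \<Rightarrow> nat set \<Rightarrow> 'a" where
  "shuf_coeff qm w S =
     (\<Prod>(k,l)\<in>{(k,l). k < l \<and> l < length w \<and> l \<in> S \<and> k \<notin> S}. qm (w ! l) (w ! k))"

definition shuf_mult :: "(nat \<Rightarrow> nat \<Rightarrow> 'a::comm_ring_1) \<Rightarrow> (nat list \<Rightarrow> 'a) \<Rightarrow> (nat list \<Rightarrow> 'a) \<Rightarrow> (nat list \<Rightarrow> 'a)" where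
  "shuf_mult qm f g w =
     (\<Sum>S\<in>Pow {0..<length w}. shuf_coeff qm w S * f (nths w S) * g (nths w ({0..<length w} - S)))"

definition letter :: "nat \<Rightarrow> (nat list \<Rightarrow> 'a::comm_ring_1)" where
  "letter i = (\<lambda>w. if w = [i] then 1 else 0)"

text \<open>Formal iterated brackets: Br s t stands for [s, t].\<close>
datatype btree = Lf nat | Br btree btree

fun letters :: "btree \<Rightarrow> nat list" where
  "letters (Lf i) = [i]"
| "letters (Br s t) = letters s @ letters t"

text \<open>chi(deg a, deg b) as the bicharacter on Z^n determined by chi(e_i,e_j) = q_ij.\<close>
definition chi :: "(nat \<Rightarrow> nat \<Rightarrow> 'a::comm_ring_1) \<Rightarrow> btree \<Rightarrow> btree \<Rightarrow> 'a" where
  "chi qm a b = prod_list [qm i j. i \<leftarrow> letters a, j \<leftarrow> letters b]"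

fun beval :: "(nat \<Rightarrow> nat \<Rightarrow> 'a::comm_ring_1) \<Rightarrow> btree \<Rightarrow> (nat list \<Rightarrow> 'a)" where
  "beval qm (Lf i) = letter i"
| "beval qm (Br s t) =
     shuf_mult qm (beval qm t) (beval qm s) - (\<lambda>w. chi qm t s * shuf_mult qm (beval qm s) (beval qm t) w)"

definition fscale :: "'a::field \<Rightarrow> (nat list \<Rightarrow> 'a) \<Rightarrow> (nat list \<Rightarrow> 'a)" where
  "fscale c f = (\<lambda>w. c * f w)"

definition nichols_lie :: "nat \<Rightarrow> (nat \<Rightarrow> nat \<Rightarrow> 'a::field) \<Rightarrow> (nat list \<Rightarrow> 'a) set" where
  "nichols_lie n qm = module.span fscale (beval qm ` {t. set (letters t) \<subseteq> {1..n}})"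

definition nichols_lie_dim :: "nat \<Rightarrow> (nat \<Rightarrow> nat \<Rightarrow> 'a::field) \<Rightarrow> nat" where
  "nichols_lie_dim n qm = vector_space.dim fscale (nichols_lie n qm)"

text \<open>Nested sums of the formula: inner j m = sum over m > n_1 > ... > n_j with
  1 <= n_i <= n_{i-1} - 2 of (N^C(n_j+1,2) - 1) * prod (N^C(n_{i-1}-n_i,2) - N^C(n_{i-1}-n_i-1,2)).\<close>
fun inner_sum :: "nat \<Rightarrow> nat \<Rightarrow> nat \<Rightarrow> int" where
  "inner_sum N 0 m = int N ^ ((m + 1) choose 2) - 1"
| "inner_sum N (Suc j) m =
     (\<Sum>k = 1..m - 2. (int N ^ ((m - k) choose 2) - int N ^ ((m - k - 1) choose 2)) * inner_sum N j k)"

definition dim_formula :: "nat \<Rightarrow> nat \<Rightarrow> int" where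
  "dim_formula N n = int N ^ ((n + 1) choose 2) - 1
     + (\<Sum>j = 1..(n - 1) div 2. (-1) ^ j * inner_sum N j n)"

end

theory Submission
  imports Defs "HOL-Library.Multiset"
begin

text \<open>
  Modulo \<open>\<LL>(V)\<close>, a word may be rotated cyclically up to the bicharacter as long as its support stays
  connected. Rotating two adjacent letters together and one after the other yields factors that differ by
  \<open>q\<inverse>\<close>, so every word with connected support containing two different letters lies in \<open>\<LL>(V)\<close>, and so do
  the powers of one letter. Since disconnected factors braided-commute, \<open>\<LL>(V)\<close> is exactly the sum of the
  homogeneous components of \<open>\<BB>(V)\<close> with nonempty connected support.

  In the quantum shuffle algebra the root vector of an interval \<open>{j..t}\<close> is, up to a scalar, a single word, and deleting
  last letters acts by skew derivations. This gives the PBW relations together with operators that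
  prove independence, so that \<open>\<BB>\<close> of an interval of \<open>k\<close> letters has dimension
  \<open>N ^ ((k + 1) choose 2)\<close>. As the support dimensions are multiplicative over separated sets, splitting a disconnected
  support at its first gap yields a recursion for \<open>dim \<LL>(V)\<close>, which unrolls to the alternating sum.
\<close>

section \<open>Quantum shuffles\<close>

text \<open>No presentation of \<BB>(V) enters. A function on words is determined by its constant
  coefficient and its right skew derivatives, so a relation is verified by differentiating both
  sides until a shorter instance of the same relation appears. Truncation at exponent
  \<open>N\<close> has the same source: the derivative of an \<open>N\<close>-th power carries the
  quantum integer of \<open>N\<close> at \<open>q\<close> or at its inverse, which is zero, while
  the smaller quantum integers are nonzero. The binomial exponent is built up one letter at a time.
  Passing from \<open>{a..<t}\<close> to \<open>{a..t}\<close> adjoins the \<open>t - a + 1\<close>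
  root vectors of intervals ending in \<open>t\<close>, each with exponents below \<open>N\<close>,
  and so multiplies the dimension by \<open>N ^ (t - a + 1)\<close>. The obstacle to rotation is
  that the bracket of two words is available only once both words are known to lie in \<LL>(V),
  whereas the complement of a connected block in a connected word may be disconnected. The scalar
  \<open>q\<inverse>\<close> is the symmetrised braiding of two neighbouring letters; since
  \<open>q\<close> is not 1, comparing two rotations of the same word leaves a nonzero multiple of
  that word.\<close>

interpretation fs: vector_space "fscale :: 'a::field \<Rightarrow> (nat list \<Rightarrow> 'a) \<Rightarrow> (nat list \<Rightarrow> 'a)"
  by unfold_locales (auto simp: fscale_def fun_eq_iff algebra_simps)

lemma fscale_apply: "fscale c f w = c * f w"
  by (simp add: fscale_def)

lemmas fun_apply = fscale_apply plus_fun_apply zero_fun_apply minus_apply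

text \<open>As rewrite rules these expand \<open>f + g\<close> into a lambda term wherever it occurs eta-expanded.\<close>

declare plus_fun_apply [simp del] zero_fun_apply [simp del] minus_apply [simp del]

definition delta :: "nat list \<Rightarrow> nat list \<Rightarrow> 'a::comm_ring_1" where
  "delta v = (\<lambda>w. if w = v then 1 else 0)"

text \<open>The right skew derivation attached to \<open>i\<close>: on a basis word it deletes a
  final \<open>i\<close> and kills words that end otherwise.\<close>

definition rd :: "nat \<Rightarrow> (nat list \<Rightarrow> 'a) \<Rightarrow> nat list \<Rightarrow> 'a" where
  "rd i f = (\<lambda>w. f (w @ [i]))"

lemma rd_simps [simp]:
  fixes f g :: "nat list \<Rightarrow> 'a::field"
  shows "rd i (f + g) = rd i f + rd i g" "rd i (f - g) = rd i f - rd i g"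
    "rd i (fscale c f) = fscale c (rd i f)" "rd i (0 :: nat list \<Rightarrow> 'a) = 0"
    "rd i (delta [] :: nat list \<Rightarrow> 'a) = 0" "rd i (delta (v @ [j]) :: nat list \<Rightarrow> 'a) = (if i = j then delta v else 0)"
  by (auto simp: rd_def fun_eq_iff delta_def fun_apply)

text \<open>This is the criterion behind the defining property of a Nichols algebra: an element with
  zero constant term and zero skew derivatives vanishes. Nearly every relation below is proved with
  it.\<close>

lemma word_fun_eqI:
  assumes "f [] = g []" "\<And>i. rd i f = rd i g"
  shows "f = g"
proof
  fix w show "f w = g w"
    using assms(1) fun_cong[OF assms(2)] by (cases w rule: rev_cases) (auto simp: rd_def)
qed

locale quantum_shuffle =
  fixes qm :: "nat \<Rightarrow> nat \<Rightarrow> 'a::field"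
begin

abbreviation mul (infixl "\<star>" 70) where "f \<star> g \<equiv> shuf_mult qm f g"

definition bich :: "nat list \<Rightarrow> nat list \<Rightarrow> 'a" where
  "bich v w = (\<Prod>i\<leftarrow>v. \<Prod>j\<leftarrow>w. qm i j)"

text \<open>The action of the group-like element of degree \<open>v\<close>: the component of degree
  \<beta> is scaled by \<chi>(deg \<open>v\<close>, \<beta>). It records what is picked up when
  \<open>v\<close> crosses \<open>f\<close>.\<close>

definition tw :: "nat list \<Rightarrow> (nat list \<Rightarrow> 'a) \<Rightarrow> nat list \<Rightarrow> 'a" where
  "tw v f = (\<lambda>w. bich v w * f w)"

lemma prod_list_mult: "(\<Prod>x\<leftarrow>xs. f x * g x :: 'a) = (\<Prod>x\<leftarrow>xs. f x) * (\<Prod>x\<leftarrow>xs. g x)"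
  by (induction xs) (auto simp: ac_simps)

text \<open>Without the \<open>NO_MATCH\<close> guard the third rule would rewrite
  \<open>bich [i] w\<close> forever, since a singleton is itself a \<open>Cons\<close>.\<close>

lemma bich_simps [simp]:
  "bich [] w = 1" "bich v [] = 1" "NO_MATCH [] v \<Longrightarrow> bich (i # v) w = bich [i] w * bich v w"
  "bich (v @ v') w = bich v w * bich v' w" "bich v (w @ w') = bich v w * bich v w'"
  "bich [i] [j] = qm i j"
proof -
  show 0: "bich (v @ v') w = bich v w * bich v' w" for v v' w by (simp add: bich_def)
  show "bich v []= 1" by (induction v) (auto simp: bich_def)
  show "bich v (w @ w') = bich v w * bich v w'" by (simp add: bich_def prod_list_mult)
qed (auto simp: bich_def)

lemma bich_Cons_right: "NO_MATCH [] w \<Longrightarrow> bich v (i # w) = bich v [i] * bich v w"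
  using bich_simps(5)[of v "[i]" w] by simp

lemma bich_perm:
  assumes "mset v = mset v'" "mset w = mset w'" shows "bich v w = bich v' w'"
proof -
  have "bich v w = (\<Prod>i\<in>#mset v. \<Prod>j\<in>#mset w. qm i j)" for v w
    unfolding bich_def by (simp flip: prod_mset_prod_list)
  then show ?thesis using assms by simp
qed

lemma chi_eq_bich: "chi qm s t = bich (letters s) (letters t)"
proof -
  have "prod_list [qm i j. i \<leftarrow> xs, j \<leftarrow> ys] = bich xs ys" for xs ys
    by (induction xs) (auto simp: bich_def)
  then show ?thesis by (simp add: chi_def)
qed

lemma tw_simps [simp]:
  "tw v (f + g) = tw v f + tw v g" "tw v (f - g) = tw v f - tw v g"
  "tw v (fscale c f) = fscale c (tw v f)" "tw v 0 = 0" "tw [] f = f"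
  "tw v (delta w) = fscale (bich v w) (delta w)" "tw v f [] = f []"
  "tw v (letter i) = fscale (bich v [i]) (letter i)"
  "tw v (tw v' f) = tw (v @ v') f"
  by (auto simp: tw_def fun_eq_iff delta_def letter_def fun_apply algebra_simps)

lemma tw_swap: "tw (v @ v') f = tw (v' @ v) f"
  by (simp add: tw_def mult.commute)

lemma rd_tw: "rd i (tw v f) = fscale (bich v [i]) (tw v (rd i f))"
  by (auto simp: rd_def tw_def fun_eq_iff fun_apply)

lemma mul_Nil [simp]: "(f \<star> g) [] = f [] * g []"
  by (simp add: shuf_mult_def shuf_coeff_def)

text \<open>The last letter of a shuffle comes either from the right factor, crossing nothing, or
  from the left factor, crossing every letter of the right one; \<open>tw [i] g\<close> collects
  these crossings. Hence \<open>rd i\<close> obeys a skew Leibniz rule, and sums over subsets can be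
  avoided from here on.\<close>

lemma mul_snoc: "(f \<star> g) (w @ [i]) = (f \<star> rd i g) w + (rd i f \<star> tw [i] g) w"
proof -
  let ?L = "length w"
  let ?h = "\<lambda>S. shuf_coeff qm (w @ [i]) S * f (nths (w @ [i]) S) * g (nths (w @ [i]) ({0..<length (w @ [i])} - S))"
  have lt: "S \<subseteq> {0..<?L} \<Longrightarrow> k \<in> S \<Longrightarrow> k < ?L" for S k by auto
  have set_eq: "Pow {0..<length (w @ [i])} = Pow {0..<?L} \<union> insert ?L ` Pow {0..<?L}"
    by (simp add: atLeast0_lessThan_Suc Pow_insert)
  have inj: "inj_on (insert ?L) (Pow {0..<?L})"
    by (rule inj_onI) (metis Pow_iff atLeastLessThan_iff insert_ident less_irrefl subset_iff)
  have "(f \<star> g) (w @ [i]) = (\<Sum>S\<in>Pow {0..<?L}. ?h S) + (\<Sum>S\<in>insert ?L ` Pow {0..<?L}. ?h S)"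
    unfolding shuf_mult_def set_eq by (rule sum.union_disjoint) auto
  also have "(\<Sum>S\<in>insert ?L ` Pow {0..<?L}. ?h S) = (\<Sum>S\<in>Pow {0..<?L}. ?h (insert ?L S))"
    by (simp add: sum.reindex[OF inj])
  also have "(\<Sum>S\<in>Pow {0..<?L}. ?h S) = (f \<star> rd i g) w"
    unfolding shuf_mult_def
  proof (rule sum.cong[OF refl])
    fix S assume "S \<in> Pow {0..<?L}"
    then have S: "S \<subseteq> {0..<?L}" by auto
    have L: "?L \<notin> S" using S by auto
    have 1: "shuf_coeff qm (w @ [i]) S = shuf_coeff qm w S"
    proof -
      let ?A = "{(k,l). k < l \<and> l < length (w @ [i]) \<and> l \<in> S \<and> k \<notin> S}"
      let ?B = "{(k,l). k < l \<and> l < ?L \<and> l \<in> S \<and> k \<notin> S}"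
      have "(k, l) \<in> ?A \<longleftrightarrow> (k, l) \<in> ?B" for k l
        using lt[OF S, of l] by (auto simp: less_Suc_eq)
      then have AB: "?A = ?B" unfolding set_eq_iff split_paired_All by (intro allI)
      show ?thesis unfolding shuf_coeff_def AB by (rule prod.cong) (auto simp: nth_append)
    qed
    have 2: "nths (w @ [i]) S = nths w S"
      using L by (simp add: nths_append)
    have 3: "nths w ({0..<Suc ?L} - S) = nths w ({0..<?L} - S)"
      unfolding nths_def by (intro arg_cong[where f = "map fst"] filter_cong) (auto simp: set_zip)
    have 4: "nths (w @ [i]) ({0..<length (w @ [i])} - S) = nths w ({0..<?L} - S) @ [i]"
      using L by (simp add: nths_append 3)
    show "?h S = shuf_coeff qm w S * f (nths w S) * rd i g (nths w ({0..<?L} - S))"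
      by (simp add: 1 2 4[simplified] rd_def)
  qed
  also have "(\<Sum>S\<in>Pow {0..<?L}. ?h (insert ?L S)) = (rd i f \<star> tw [i] g) w"
    unfolding shuf_mult_def
  proof (rule sum.cong[OF refl])
    fix S assume "S \<in> Pow {0..<?L}"
    then have S: "S \<subseteq> {0..<?L}" by auto
    have 2: "nths (w @ [i]) (insert ?L S) = nths w S @ [i]"
    proof -
      have "nths w (insert ?L S) = nths w S"
        unfolding nths_def by (intro arg_cong[where f = "map fst"] filter_cong) (auto simp: set_zip)
      then show ?thesis by (simp add: nths_append)
    qed
    have 4: "nths (w @ [i]) ({0..<length (w @ [i])} - insert ?L S) = nths w ({0..<?L} - S)"
    proof -
      have "nths w ({0..<Suc ?L} - insert ?L S) = nths w ({0..<?L} - S)"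
        unfolding nths_def by (intro arg_cong[where f = "map fst"] filter_cong) (auto simp: set_zip)
      then show ?thesis by (simp add: nths_append)
    qed
    have 5: "bich [i] (nths w A) = (\<Prod>k\<in>A. qm i (w ! k))" if "A \<subseteq> {0..<length w}" for A w
      using that
    proof (induction w arbitrary: A rule: rev_induct)
      case Nil then show ?case by simp
    next
      case (snoc x w)
      have fin: "finite A" using snoc.prems finite_subset by blast
      have a: "nths w A = nths w (A - {length w})"
        unfolding nths_def by (intro arg_cong[where f = "map fst"] filter_cong) (auto simp: set_zip)
      have A: "A - {length w} \<subseteq> {0..<length w}" using snoc.prems by (auto simp: less_Suc_eq)
      have b: "(\<Prod>k\<in>A - {length w}. qm i ((w @ [x]) ! k)) = (\<Prod>k\<in>A - {length w}. qm i (w ! k))"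
        using A by (intro prod.cong) (auto simp: nth_append)
      have IH: "bich [i] (nths w A) = (\<Prod>k\<in>A - {length w}. qm i (w ! k))"
        by (subst a) (rule snoc.IH[OF A])
      show ?case
      proof (cases "length w \<in> A")
        case True
        have "(\<Prod>k\<in>A. qm i ((w @ [x]) ! k)) = qm i x * (\<Prod>k\<in>A - {length w}. qm i ((w @ [x]) ! k))"
          using True by (subst prod.remove[OF fin True]) simp
        then show ?thesis using True b
          by (simp add: nths_append IH mult.commute)
      next
        case False
        then show ?thesis using b by (simp add: nths_append IH)
      qed
    qed
    \<comment> \<open>Giving the last position to the left factor adds exactly the crossings of that
      position with all positions of the right factor.\<close>
    have 1: "shuf_coeff qm (w @ [i]) (insert ?L S) = shuf_coeff qm w S * bich [i] (nths w ({0..<?L} - S))"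
    proof -
      let ?A = "{(k,l). k < l \<and> l < ?L \<and> l \<in> S \<and> k \<notin> S}"
      let ?B = "(\<lambda>k. (k, ?L)) ` ({0..<?L} - S)"
      have e: "{(k,l). k < l \<and> l < length (w @ [i]) \<and> l \<in> insert ?L S \<and> k \<notin> insert ?L S} = ?A \<union> ?B"
        using S by auto
      have "finite ?A" by (rule finite_subset[of _ "{..<?L} \<times> {..<?L}"]) auto
      then have "shuf_coeff qm (w @ [i]) (insert ?L S) =
        (\<Prod>(k,l)\<in>?A. qm ((w@[i]) ! l) ((w@[i]) ! k)) * (\<Prod>(k,l)\<in>?B. qm ((w@[i]) ! l) ((w@[i]) ! k))"
        unfolding shuf_coeff_def e by (intro prod.union_disjoint) auto
      also have "(\<Prod>(k,l)\<in>?A. qm ((w@[i]) ! l) ((w@[i]) ! k)) = shuf_coeff qm w S"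
        unfolding shuf_coeff_def by (intro prod.cong) (auto simp: nth_append)
      also have "(\<Prod>(k,l)\<in>?B. qm ((w@[i]) ! l) ((w@[i]) ! k)) = (\<Prod>k\<in>{0..<?L} - S. qm i (w ! k))"
        by (subst prod.reindex) (auto simp: inj_on_def nth_append intro!: prod.cong)
      finally show ?thesis by (simp add: 5)
    qed
    show "?h (insert ?L S) = shuf_coeff qm w S * rd i f (nths w S) * tw [i] g (nths w ({0..<?L} - S))"
      by (simp add: 1[simplified] 2 4[simplified] rd_def tw_def)
  qed
  finally show ?thesis .
qed

lemma rd_mul: "rd i (f \<star> g) = f \<star> rd i g + rd i f \<star> tw [i] g"
  by (rule ext) (subst rd_def, simp add: mul_snoc fun_apply)

lemma mul_linear [simp]:
  "(f + f') \<star> g = f \<star> g + f' \<star> g" "g \<star> (f + f') = g \<star> f + g \<star> f'"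
  "(f - f') \<star> g = f \<star> g - f' \<star> g" "g \<star> (f - f') = g \<star> f - g \<star> f'"
  "fscale c f \<star> g = fscale c (f \<star> g)" "g \<star> fscale c f = fscale c (g \<star> f)"
  "0 \<star> g = 0" "g \<star> 0 = 0"
  by (auto simp: shuf_mult_def fun_eq_iff fun_apply algebra_simps sum.distrib sum_subtractf sum_distrib_left)

lemma mul_sum: "(\<Sum>i\<in>I. f i) \<star> g = (\<Sum>i\<in>I. f i \<star> g)" "g \<star> (\<Sum>i\<in>I. f i) = (\<Sum>i\<in>I. g \<star> f i)"
  by (induction I rule: infinite_finite_induct) auto

lemma tw_mul: "tw v (f \<star> g) = tw v f \<star> tw v g"
proof
  fix w show "tw v (f \<star> g) w = (tw v f \<star> tw v g) w"
  proof (induction w arbitrary: f g rule: rev_induct)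
    case Nil then show ?case by simp
  next
    case (snoc i w)
    have "tw v (f \<star> g) (w @ [i]) = bich v [i] * (tw v (f \<star> rd i g) w + tw v (rd i f \<star> tw [i] g) w)"
      by (simp add: tw_def mul_snoc algebra_simps)
    also have "\<dots> = (tw v f \<star> tw v g) (w @ [i])"
      by (simp add: mul_snoc snoc.IH rd_tw fun_apply tw_swap[of v "[i]"] distrib_left)
    finally show ?case .
  qed
qed

text \<open>The Leibniz rule reduces both sides to the same three products at a shorter word; the
  compatibility of the shuffle scalars is contained in \<open>tw_mul\<close>.\<close>

lemma mul_assoc: "f \<star> g \<star> h = f \<star> (g \<star> h)"
proof
  fix w show "(f \<star> g \<star> h) w = (f \<star> (g \<star> h)) w"
    by (induction w arbitrary: f g h rule: rev_induct) (auto simp: mul_snoc rd_mul tw_mul fun_apply)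
qed

lemma mul_one [simp]: "f \<star> delta [] = f" "delta [] \<star> f = f"
proof -
  have "(f \<star> delta []) w = f w \<and> (delta [] \<star> f) w = f w" for w
  proof (induction w arbitrary: f rule: rev_induct)
    case Nil then show ?case by (simp add: delta_def)
  next
    case (snoc i w)
    from snoc[of "rd i f"] show ?case by (simp add: mul_snoc fun_apply) (simp add: rd_def)
  qed
  then show "f \<star> delta [] = f" "delta [] \<star> f = f" by auto
qed

end

lemma letter_eq_delta: "letter i = delta [i]"
  by (auto simp: letter_def delta_def)

lemma rd_letter [simp]: "rd i (letter j :: nat list \<Rightarrow> 'a::field) = (if i = j then delta [] else 0)"
  using rd_simps(6)[of i "[]" j] by (simp add: letter_eq_delta)

lemma letter_Nil [simp]: "letter i [] = 0"
  by (simp add: letter_def)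

text \<open>With \<open>B\<close> empty this becomes a proof that \<open>F\<close> vanishes on a
  span, a use made of it several times below.\<close>

lemma span_linear_image:
  fixes F :: "(nat list \<Rightarrow> 'a::field) \<Rightarrow> (nat list \<Rightarrow> 'a)"
  assumes "\<And>x y. F (x + y) = F x + F y" "\<And>c x. F (fscale c x) = fscale c (F x)"
    and "\<And>x. x \<in> A \<Longrightarrow> F x \<in> fs.span B" and "x \<in> fs.span A"
  shows "F x \<in> fs.span B"
  using assms(4)
proof (induction rule: fs.span_induct)
  case base
  have "F 0 = 0" using assms(2)[of 0 0] by simp
  then show ?case using assms by (auto intro!: fs.subspaceI fs.span_add fs.span_scale fs.span_zero)
qed (use assms in auto)

lemma span_bilinear_image:
  fixes F :: "(nat list \<Rightarrow> 'a::field) \<Rightarrow> (nat list \<Rightarrow> 'a) \<Rightarrow> (nat list \<Rightarrow> 'a)"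
  assumes "\<And>x y z. F (x + y) z = F x z + F y z" "\<And>c x z. F (fscale c x) z = fscale c (F x z)"
    and "\<And>x y z. F z (x + y) = F z x + F z y" "\<And>c x z. F z (fscale c x) = fscale c (F z x)"
    and "\<And>x y. x \<in> A \<Longrightarrow> y \<in> B \<Longrightarrow> F x y \<in> fs.span C" and "x \<in> fs.span A" "y \<in> fs.span B"
  shows "F x y \<in> fs.span C"
proof (rule span_linear_image[of "\<lambda>x. F x y", OF _ _ _ assms(6)])
  fix x assume "x \<in> A"
  then show "F x y \<in> fs.span C"
    by (intro span_linear_image[of "F x", OF _ _ _ assms(7)] assms)
qed (rule assms)+

section \<open>Connected supports\<close>

definition conn :: "nat set \<Rightarrow> bool" where
  "conn S \<longleftrightarrow> S \<noteq> {} \<and> (\<forall>x\<in>S. \<forall>z\<in>S. {x..z} \<subseteq> S)"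

lemma connD: "conn S \<Longrightarrow> x \<in> S \<Longrightarrow> z \<in> S \<Longrightarrow> x \<le> y \<Longrightarrow> y \<le> z \<Longrightarrow> y \<in> S"
  by (force simp: conn_def)

lemma conn_singleton [simp]: "conn {i}"
  by (auto simp: conn_def)

lemma conn_Un:
  assumes A: "conn A" and B: "conn B" and xy: "x \<in> A" "y \<in> B" "x \<le> Suc y" "y \<le> Suc x"
  shows "conn (A \<union> B)"
proof -
  have "r \<in> A \<union> B" if p: "p \<in> A \<union> B" and s: "s \<in> A \<union> B" and r: "p \<le> r" "r \<le> s" for p r s
  proof -
    have 1: ?thesis if "p \<in> A" "s \<in> B"
    proof (cases "r \<le> x")
      case True then show ?thesis using connD[OF A that(1) xy(1) r(1)] by simp
    next
      case False
      then have "y \<le> r" using xy by simp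
      then show ?thesis using connD[OF B xy(2) that(2) _ r(2)] by simp
    qed
    have 2: ?thesis if "p \<in> B" "s \<in> A"
    proof (cases "r \<le> y")
      case True then show ?thesis using connD[OF B that(1) xy(2) r(1)] by simp
    next
      case False
      then have "x \<le> r" using xy by simp
      then show ?thesis using connD[OF A xy(1) that(2) _ r(2)] by simp
    qed
    consider "p \<in> A" "s \<in> A" | "p \<in> B" "s \<in> B" | "p \<in> A" "s \<in> B" | "p \<in> B" "s \<in> A"
      using p s by blast
    then show ?thesis
    proof cases
      case 1 then show ?thesis using connD[OF A _ _ r] by simp
    next
      case 2 then show ?thesis using connD[OF B _ _ r] by simp
    qed (use 1 2 in simp_all)
  qed
  then have "{p..s} \<subseteq> A \<union> B" if "p \<in> A \<union> B" "s \<in> A \<union> B" for p s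
    using that by (meson atLeastAtMost_iff subsetI)
  moreover have "A \<union> B \<noteq> {}" using xy by auto
  ultimately show ?thesis unfolding conn_def by blast
qed

lemma conn_pair: "conn {i, Suc i}"
  using conn_Un[of "{i}" "{Suc i}" i "Suc i"] by (simp add: insert_commute)

section \<open>Products of generators and homogeneous parts of the Lie algebra\<close>

context quantum_shuffle
begin

text \<open>The monomial of \<BB>(V) with these letters, a shuffle product. It differs from the
  basis word \<open>delta w\<close> of the ambient coalgebra, which need not lie in
  \<BB>(V).\<close>

primrec xw :: "nat list \<Rightarrow> nat list \<Rightarrow> 'a" where
  "xw [] = delta []"
| "xw (i # w) = letter i \<star> xw w"

lemma xw_append: "xw (u @ v) = xw u \<star> xw v"
  by (induction u) (auto simp: mul_assoc)

lemma tw_xw: "tw v (xw w) = fscale (bich v w) (xw w)"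
  by (induction w) (auto simp: tw_mul bich_Cons_right fs.scale_one fs.scale_scale mult.commute)

definition commuting :: "nat \<Rightarrow> nat \<Rightarrow> bool" where
  "commuting i j \<longleftrightarrow> i \<noteq> j \<and> qm i j * qm j i = 1"

definition sep :: "nat list \<Rightarrow> nat list \<Rightarrow> bool" where
  "sep u v \<longleftrightarrow> (\<forall>i\<in>set u. \<forall>j\<in>set v. commuting i j)"

lemma bich_replicate: "bich [i] (replicate k j) = qm i j ^ k"
  by (induction k) (simp_all add: bich_def)

text \<open>The derivatives by \<open>i\<close> agree at once; those by \<open>j\<close> are x_i and
  q_ij q_ji x_i.\<close>

lemma letter_commute:
  assumes "commuting i j"
  shows "letter i \<star> letter j = fscale (qm i j) (letter j \<star> letter i)"
proof (rule word_fun_eqI)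
  fix k
  have "qm i j * qm j i = 1" "i \<noteq> j" using assms by (auto simp: commuting_def)
  then show "rd k (letter i \<star> letter j) = rd k (fscale (qm i j) (letter j \<star> letter i))"
    by (auto simp: rd_mul)
qed (simp add: fun_apply)

lemma letter_xw_commute:
  assumes "sep [i] v"
  shows "letter i \<star> xw v = fscale (bich [i] v) (xw v \<star> letter i)"
  using assms
proof (induction v)
  case Nil then show ?case by simp
next
  case (Cons j v)
  then have c: "commuting i j" and s: "sep [i] v" by (auto simp: sep_def)
  have "letter i \<star> xw (j # v) = (letter i \<star> letter j) \<star> xw v" by (simp add: mul_assoc)
  also have "\<dots> = fscale (qm i j) (letter j \<star> (letter i \<star> xw v))"
    by (simp add: letter_commute[OF c] mul_assoc)
  also have "\<dots> = fscale (bich [i] (j # v)) (xw (j # v) \<star> letter i)"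
    by (simp add: Cons.IH[OF s] mul_assoc bich_Cons_right)
  finally show ?case .
qed

lemma xw_commute:
  assumes "sep u v"
  shows "xw (u @ v) = fscale (bich u v) (xw (v @ u))"
  using assms
proof (induction u)
  case Nil then show ?case by simp
next
  case (Cons i u)
  then have c: "sep [i] v" and s: "sep u v" by (auto simp: sep_def)
  have "xw ((i # u) @ v) = fscale (bich u v) ((letter i \<star> xw v) \<star> xw u)"
    using Cons.IH[OF s] by (simp add: xw_append mul_assoc)
  also have "\<dots> = fscale (bich (i # u) v) (xw (v @ (i # u)))"
    by (cases u) (simp_all add: letter_xw_commute[OF c] mul_assoc xw_append mult.commute)
  finally show ?case .
qed

lemma bich_sep:
  assumes "sep u v" shows "bich u v * bich v u = 1"
proof -
  have 1: "bich [i] v * bich v [i] = 1" if "sep [i] v" for i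
    using that
  proof (induction v)
    case (Cons j v)
    have "bich [i] (j # v) = qm i j * bich [i] v" "bich (j # v) [i] = qm j i * bich v [i]"
      using bich_simps(5)[of "[i]" "[j]" v] bich_simps(4)[of "[j]" v "[i]"] by simp_all
    then have e: "bich [i] (j # v) * bich (j # v) [i] = (qm i j * qm j i) * (bich [i] v * bich v [i])"
      by simp
    have "bich [i] v * bich v [i] = 1" "qm i j * qm j i = 1"
      using Cons by (auto simp: sep_def commuting_def)
    then show ?case unfolding e by simp
  qed simp
  show ?thesis using assms
  proof (induction u)
    case (Cons i u)
    have "bich (i # u) v = bich [i] v * bich u v" "bich v (i # u) = bich v [i] * bich v u"
      using bich_simps(4)[of "[i]" u v] bich_simps(5)[of v "[i]" u] by simp_all
    then have e: "bich (i # u) v * bich v (i # u) = (bich [i] v * bich v [i]) * (bich u v * bich v u)"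
      by simp
    have "bich u v * bich v u = 1" "bich [i] v * bich v [i] = 1"
      using Cons 1[of i] by (auto simp: sep_def)
    then show ?case unfolding e by simp
  qed simp
qed

text \<open>The multidegree is kept as a multiset because the scalar in a bracket depends on nothing
  else; on a fixed pair of multidegrees the bracket is therefore bilinear.\<close>

definition lie_comp :: "nat multiset \<Rightarrow> (nat list \<Rightarrow> 'a) set" where
  "lie_comp M = fs.span (beval qm ` {t. mset (letters t) = M})"

lemma lie_comp_closed [simp]:
  "0 \<in> lie_comp M" "f \<in> lie_comp M \<Longrightarrow> fscale c f \<in> lie_comp M"
  "f \<in> lie_comp M \<Longrightarrow> g \<in> lie_comp M \<Longrightarrow> f + g \<in> lie_comp M" "f \<in> lie_comp M \<Longrightarrow> g \<in> lie_comp M \<Longrightarrow> f - g \<in> lie_comp M"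
  by (auto simp: lie_comp_def fs.span_add fs.span_diff fs.span_scale fs.span_zero)

lemma lie_comp_scaleD: "fscale c f \<in> lie_comp M \<Longrightarrow> c \<noteq> 0 \<Longrightarrow> f \<in> lie_comp M"
  using lie_comp_closed(2)[of "fscale c f" M "inverse c"] by simp

lemma bracket_lie_comp:
  assumes "f \<in> lie_comp (mset u)" "g \<in> lie_comp (mset v)"
  shows "g \<star> f - fscale (bich v u) (f \<star> g) \<in> lie_comp (mset (v @ u))"
  unfolding lie_comp_def
proof (rule span_bilinear_image[of "\<lambda>f g. g \<star> f - fscale (bich v u) (f \<star> g)",
      OF _ _ _ _ _ assms[unfolded lie_comp_def]])
  fix x y assume "x \<in> beval qm ` {t. mset (letters t) = mset u}" "y \<in> beval qm ` {t. mset (letters t) = mset v}"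
  then obtain s t where st: "x = beval qm s" "y = beval qm t" "mset (letters s) = mset u" "mset (letters t) = mset v"
    by auto
  have "y \<star> x - fscale (bich v u) (x \<star> y) = beval qm (Br s t)"
    using bich_perm[OF st(4,3)] by (simp add: st(1,2) chi_eq_bich fscale_def)
  then show "y \<star> x - fscale (bich v u) (x \<star> y) \<in> fs.span (beval qm ` {t. mset (letters t) = mset (v @ u)})"
    using st by (intro fs.span_base) (auto simp del: beval.simps)
qed (auto simp: fs.scale_right_distrib fs.scale_right_diff_distrib fs.scale_left_commute mult.commute)

end

section \<open>Braidings of Cartan type A and cyclic rotation\<close>

locale cartan_A = quantum_shuffle qm for qm :: "nat \<Rightarrow> nat \<Rightarrow> 'a::field" +
  fixes q :: 'a and n N :: nat
  assumes N: "N \<ge> 2" and qN: "q ^ N = 1" and qord: "\<And>k. 0 < k \<Longrightarrow> k < N \<Longrightarrow> q ^ k \<noteq> 1"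
    and diag: "\<And>i. i \<in> {1..n} \<Longrightarrow> qm i i = q"
    and adj: "\<And>i. 1 \<le> i \<Longrightarrow> i < n \<Longrightarrow> qm i (Suc i) * qm (Suc i) i = inverse q"
    and far: "\<And>i j. i \<in> {1..n} \<Longrightarrow> j \<in> {1..n} \<Longrightarrow> i + 2 \<le> j \<or> j + 2 \<le> i \<Longrightarrow> qm i j * qm j i = 1"
begin

lemma q_nz [simp]: "q \<noteq> 0"
  using qN N by (auto simp: power_0_left)

lemma q_n1 [simp]: "q \<noteq> 1"
  using qord[of 1] N by auto

lemma qm_nz: "i \<in> {1..n} \<Longrightarrow> j \<in> {1..n} \<Longrightarrow> qm i j \<noteq> 0"
proof -
  assume ij: "i \<in> {1..n}" "j \<in> {1..n}"
  consider "i = j" | "j = Suc i" | "i = Suc j" | "i + 2 \<le> j \<or> j + 2 \<le> i" by linarith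
  then show ?thesis
  proof cases
    case 1 then show ?thesis using diag[OF ij(1)] by simp
  next
    case 2
    then have "qm i j * qm j i = inverse q" using adj[of i] ij by auto
    then show ?thesis by auto
  next
    case 3
    then have "qm j i * qm i j = inverse q" using adj[of j] ij by auto
    then show ?thesis by auto
  next
    case 4 then show ?thesis using far[OF ij] by auto
  qed
qed

lemma bich_nz: "set u \<subseteq> {1..n} \<Longrightarrow> set v \<subseteq> {1..n} \<Longrightarrow> bich u v \<noteq> 0"
proof -
  assume "set u \<subseteq> {1..n}" "set v \<subseteq> {1..n}"
  then have nz: "qm i j \<noteq> 0" if "i \<in> set u" "j \<in> set v" for i j using qm_nz that by blast
  show ?thesis unfolding bich_def prod_list_zero_iff set_map using nz
    by (smt (verit) imageE prod_list_zero_iff set_map)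
qed

lemma commuting_far: "i \<in> {1..n} \<Longrightarrow> j \<in> {1..n} \<Longrightarrow> i + 2 \<le> j \<or> j + 2 \<le> i \<Longrightarrow> commuting i j"
  using far by (auto simp: commuting_def)

lemma rd_letter_power:
  assumes "i \<in> {1..n}"
  shows "rd j (xw (replicate k i)) = (if i = j then fscale (\<Sum>a<k. q ^ a) (xw (replicate (k - 1) i)) else 0)"
proof (induction k)
  case 0 then show ?case by simp
next
  case (Suc k)
  have b: "bich [i] (replicate k i) = q ^ k"
    by (simp add: bich_replicate diag[OF assms])
  have "rd j (xw (replicate (Suc k) i)) = letter i \<star> rd j (xw (replicate k i)) + (if i = j then fscale (q ^ k) (xw (replicate k i)) else 0)"
    by (cases "j = i") (simp_all add: rd_mul tw_xw b)
  also have "\<dots> = (if i = j then fscale (\<Sum>a<Suc k. q ^ a) (xw (replicate k i)) else 0)"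
    using Suc.IH by (cases k) (auto simp: fs.scale_left_distrib)
  finally show ?case by simp
qed

text \<open>The derivative of the \<open>N\<close>-th power carries the factor
  \<open>1 + q + ... + q ^ (N - 1)\<close>, which is zero.\<close>

lemma letter_power_N:
  assumes "i \<in> {1..n}" "N \<le> k"
  shows "xw (replicate k i) = 0"
proof -
  have z: "xw (replicate N i) = 0"
  proof (rule word_fun_eqI)
    show "xw (replicate N i) [] = 0 []" using N by (cases N) (auto simp: fun_apply)
    show "rd j (xw (replicate N i)) = rd j 0" for j
      using geometric_sum[OF q_n1, of N] qN by (simp add: rd_letter_power[OF assms(1)])
  qed
  have "xw (replicate (N + d) i) = 0" for d
    by (simp add: replicate_add xw_append z)
  from this[of "k - N"] show ?thesis using assms(2) by simp
qed

text \<open>Letters on opposite sides of the missing letter \<open>c\<close> differ by at least two,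
  so they can be sorted at the cost of a scalar.\<close>

lemma xw_split:
  assumes "set v \<subseteq> {1..n}" "c \<notin> set v"
  shows "\<exists>s. xw v = fscale s (xw (filter (\<lambda>x. x < c) v @ filter (\<lambda>x. c < x) v))"
  using assms
proof (induction v)
  case Nil
  show ?case by (rule exI[of _ 1]) simp
next
  case (Cons x v)
  let ?a = "filter (\<lambda>x. x < c) v" and ?b = "filter (\<lambda>x. c < x) v"
  have "set v \<subseteq> {1..n}" "c \<notin> set v" using Cons.prems by auto
  from Cons.IH[OF this] obtain s where s: "xw v = fscale s (xw (?a @ ?b))" by blast
  show ?case
  proof (cases "x < c")
    case True
    then show ?thesis by (intro exI[of _ s]) (simp add: s)
  next
    case False
    then have c: "c < x" using Cons.prems by auto
    have "sep [x] ?a" using c Cons.prems(1) by (fastforce simp: sep_def intro!: commuting_far)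
    then have "letter x \<star> xw ?a = fscale (bich [x] ?a) (xw ?a \<star> letter x)" by (rule letter_xw_commute)
    then have "xw (x # v) = fscale (s * bich [x] ?a) (xw (?a @ x # ?b))"
      by (simp add: s xw_append flip: mul_assoc)
    then show ?thesis using c by auto
  qed
qed

text \<open>Cutting a disconnected \<open>v\<close> at a letter \<open>c\<close> of \<open>u\<close> into commuting halves \<open>v1\<close>, \<open>v2\<close>, one rotates
  \<open>u v1\<close> past \<open>v2\<close> and then \<open>v2 u\<close> past \<open>v1\<close>; the two extra factors cancel.\<close>

lemma rotate_block:
  assumes IH: "\<And>u. length u < L \<Longrightarrow> conn (set u) \<Longrightarrow> set u \<subseteq> {1..n} \<Longrightarrow> xw u \<in> lie_comp (mset u)"
    and "length (u @ v) \<le> L" "conn (set u)" "conn (set (u @ v))" "set (u @ v) \<subseteq> {1..n}"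
  shows "xw (u @ v) - fscale (bich u v) (xw (v @ u)) \<in> lie_comp (mset (u @ v))"
  using assms(2-)
proof (induction "length v" arbitrary: u v rule: less_induct)
  case less
  have une: "u \<noteq> []" using less.prems(2) by (auto simp: conn_def)
  consider "v = []" | "v \<noteq> []" "conn (set v)" | "v \<noteq> []" "\<not> conn (set v)" by auto
  then show ?case
  proof cases
    case 1 then show ?thesis by simp
  next
    case 2
    have "0 < length u" "0 < length v" "length u + length v \<le> L"
      using une 2 less.prems(1) by simp_all
    then have "length u < L" "length v < L" by linarith+
    then have "xw u \<in> lie_comp (mset u)" "xw v \<in> lie_comp (mset v)"
      using 2 less.prems by (simp_all add: IH)
    from bracket_lie_comp[OF this(2,1)] show ?thesis by (simp only: xw_append)
  next
    case 3
    then obtain x y where xy: "x \<in> set v" "y \<in> set v" "\<not> {x..y} \<subseteq> set v"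
      unfolding conn_def by auto
    then obtain c where c: "c \<in> {x..y}" "c \<notin> set v" by (meson subsetI)
    then have xcy: "x \<in> set v" "y \<in> set v" "x \<le> c" "c \<le> y" "c \<notin> set v" using xy by auto
    have cu: "c \<in> set u" using connD[OF less.prems(3), of x y c] xcy by auto
    define v1 v2 where v12: "v1 = filter (\<lambda>x. x < c) v" "v2 = filter (\<lambda>x. c < x) v"
    have sub: "set u \<subseteq> {1..n}" "set v1 \<subseteq> {1..n}" "set v2 \<subseteq> {1..n}" "set v \<subseteq> {1..n}"
      using less.prems(4) by (auto simp: v12)
    have sv: "set v = set v1 \<union> set v2" using xcy(5) by (auto simp: v12) (metis nat_neq_iff)
    have lt: "a \<in> set v1 \<Longrightarrow> a < c" "a \<in> set v2 \<Longrightarrow> c < a" for a by (auto simp: v12)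
    have perm: "mset (v1 @ v2) = mset v"
    proof -
      have "filter (\<lambda>x. c < x) v = filter (\<lambda>x. \<not> x < c) v"
        using xcy(5) by (intro filter_cong) (auto simp: not_less le_less)
      then show ?thesis by (simp add: v12 mset_filter multiset_partition[symmetric])
    qed
    have len: "length v = length v1 + length v2" using arg_cong[OF perm, of size] by simp
    have "x < c" "c < y" using xcy by (metis le_neq_implies_less)+
    then have ne: "v1 \<noteq> []" "v2 \<noteq> []" using xcy by (auto simp: v12 filter_empty_conv)
    obtain s where s: "xw v = fscale s (xw (v1 @ v2))"
      unfolding v12 using xw_split[OF sub(4) xcy(5)] by auto
    have sep: "sep v1 v2"
      using sub lt by (fastforce simp: sep_def intro!: commuting_far)
    have conn_uv: "conn (set u \<union> set v)" using less.prems(3) by simp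
    \<comment> \<open>A point \<open>r\<close> missing from \<open>u @ v1\<close> would lie in
      \<open>v2\<close>, hence above \<open>c\<close>. The larger endpoint then exceeds
      \<open>c\<close>, so it belongs to \<open>u\<close>, as does \<open>c\<close>, and
      connectedness of \<open>u\<close> puts \<open>r\<close> into \<open>u\<close>. The mirror
      argument gives \<open>c2\<close>.\<close>
    have c1: "conn (set (u @ v1))"
      unfolding conn_def
    proof (intro conjI ballI subsetI)
      fix p z r assume p: "p \<in> set (u @ v1)" "z \<in> set (u @ v1)" "r \<in> {p..z}"
      then have r: "r \<in> set u \<union> set v" using connD[OF conn_uv, of p z r] by (auto simp: sv)
      show "r \<in> set (u @ v1)"
      proof (rule ccontr)
        assume "r \<notin> set (u @ v1)"
        then have "c < r" "r \<notin> set u" using r lt sv by auto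
        then show False using connD[OF less.prems(2) cu, of z r] p lt by fastforce
      qed
    qed (use une in simp)
    have c2: "conn (set (v2 @ u))"
      unfolding conn_def
    proof (intro conjI ballI subsetI)
      fix p z r assume p: "p \<in> set (v2 @ u)" "z \<in> set (v2 @ u)" "r \<in> {p..z}"
      then have r: "r \<in> set u \<union> set v" using connD[OF conn_uv, of p z r] by (auto simp: sv)
      show "r \<in> set (v2 @ u)"
      proof (rule ccontr)
        assume "r \<notin> set (v2 @ u)"
        then have "r < c" "r \<notin> set u" using r lt sv by auto
        then show False using connD[OF less.prems(2) _ cu, of p r] p lt by fastforce
      qed
    qed (use une in simp)
    have m: "mset ((u @ v1) @ v2) = mset (u @ v)" "mset ((v2 @ u) @ v1) = mset (u @ v)"
      using perm by (simp_all add: ac_simps)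
    have sm: "set ((u @ v1) @ v2) = set (u @ v)" "set ((v2 @ u) @ v1) = set (u @ v)" using sv by auto
    have R1: "xw ((u @ v1) @ v2) - fscale (bich (u @ v1) v2) (xw (v2 @ u @ v1)) \<in> lie_comp (mset (u @ v))"
      using less.hyps[of v2 "u @ v1"] less.prems c1 sm m len ne sub by simp
    have "xw ((v2 @ u) @ v1) - fscale (bich (v2 @ u) v1) (xw (v1 @ v2 @ u)) \<in> lie_comp (mset ((v2 @ u) @ v1))"
      using less.hyps[of v1 "v2 @ u"] less.prems c2 sm len ne sub by simp
    then have R2: "xw ((v2 @ u) @ v1) - fscale (bich (v2 @ u) v1) (xw (v1 @ v2 @ u)) \<in> lie_comp (mset (u @ v))"
      unfolding m(2) .
    have p: "bich (u @ v1) v2 * bich (v2 @ u) v1 = bich u v"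
    proof -
      have "bich (u @ v1) v2 * bich (v2 @ u) v1 = bich u (v1 @ v2) * (bich v1 v2 * bich v2 v1)"
        by (simp add: ac_simps)
      then show ?thesis by (simp only: bich_sep[OF sep] bich_perm[OF refl perm, of u] mult_1_right)
    qed
    have "xw (u @ v) - fscale (bich u v) (xw (v @ u)) =
      fscale s ((xw ((u @ v1) @ v2) - fscale (bich (u @ v1) v2) (xw (v2 @ u @ v1))) +
        fscale (bich (u @ v1) v2) (xw ((v2 @ u) @ v1) - fscale (bich (v2 @ u) v1) (xw (v1 @ v2 @ u))))"
      unfolding p[symmetric]
      by (simp add: xw_append s mul_assoc fs.scale_right_diff_distrib fs.scale_right_distrib ac_simps del: bich_simps)
    also have "\<dots> \<in> lie_comp (mset (u @ v))" by (rule lie_comp_closed(2)[OF lie_comp_closed(3)[OF R1 lie_comp_closed(2)[OF R2]]])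
    finally show ?thesis .
  qed
qed

end

context cartan_A
begin

text \<open>A single letter is a connected block, so \<open>rotate_block\<close> applies to the
  letters of \<open>u\<close> one at a time. Thus membership is invariant under cyclic rotation even
  when neither \<open>u\<close> nor \<open>v\<close> is connected.\<close>

lemma rotate_letters:
  assumes IH: "\<And>u. length u < length w \<Longrightarrow> conn (set u) \<Longrightarrow> set u \<subseteq> {1..n} \<Longrightarrow> xw u \<in> lie_comp (mset u)"
    and w: "mset w = mset (u @ v)" and c: "conn (set w)" "set w \<subseteq> {1..n}" and vu: "xw (v @ u) \<in> lie_comp (mset w)"
  shows "xw (u @ v) \<in> lie_comp (mset w)"
  using w vu
proof (induction u arbitrary: v)
  case Nil then show ?case by simp
next
  case (Cons i u)
  have m: "mset ([i] @ (u @ v)) = mset w" using Cons.prems by simp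
  then have s: "set ([i] @ (u @ v)) = set w" by (rule mset_eq_setD)
  have "xw (u @ (v @ [i])) \<in> lie_comp (mset w)"
    using Cons.prems by (intro Cons.IH) auto
  then have 1: "xw ((u @ v) @ [i]) \<in> lie_comp (mset w)" by simp
  have "xw ([i] @ (u @ v)) - fscale (bich [i] (u @ v)) (xw ((u @ v) @ [i])) \<in> lie_comp (mset ([i] @ (u @ v)))"
  proof (rule rotate_block[where L = "length w", OF IH])
    show "length ([i] @ (u @ v)) \<le> length w" using arg_cong[OF m, of size] by simp
  qed (use s c in simp_all)
  from lie_comp_closed(3)[OF this[unfolded m] lie_comp_closed(2)[OF 1, of "bich [i] (u @ v)"]] show ?case by simp
qed

text \<open>Rotating the block \<open>x\<^sub>i x\<^sub>i\<^sub>+\<^sub>1\<close> at once and letter by letter gives factors that differ by \<open>q\<inverse>\<close>.\<close>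

lemma xw_adjacent_lie_comp:
  assumes IH: "\<And>u. length u < L \<Longrightarrow> conn (set u) \<Longrightarrow> set u \<subseteq> {1..n} \<Longrightarrow> xw u \<in> lie_comp (mset u)"
    and L: "length v + 2 \<le> L" and c: "conn (set (i # Suc i # v))" and sub: "set (i # Suc i # v) \<subseteq> {1..n}"
  shows "xw (i # Suc i # v) \<in> lie_comp (mset (i # Suc i # v))"
proof -
  let ?M = "mset (i # Suc i # v)" and ?j = "Suc i"
  let ?p = "bich [i, ?j] v" and ?a = "bich [i] (?j # v)" and ?b = "bich [?j] (v @ [i])"
  have 1: "xw ([i, ?j] @ v) - fscale ?p (xw (v @ [i, ?j])) \<in> lie_comp (mset ([i, ?j] @ v))"
    by (rule rotate_block[where L = L, OF IH]) (use L c sub conn_pair[of i] in simp_all)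
  have 2: "xw ([i] @ (?j # v)) - fscale ?a (xw ((?j # v) @ [i])) \<in> lie_comp (mset ([i] @ (?j # v)))"
    by (rule rotate_block[where L = L, OF IH]) (use L c sub conn_pair[of i] in simp_all)
  have s: "set ([?j] @ (v @ [i])) = set (i # ?j # v)" by auto
  have 3: "xw ([?j] @ (v @ [i])) - fscale ?b (xw ((v @ [i]) @ [?j])) \<in> lie_comp (mset ([?j] @ (v @ [i])))"
    by (rule rotate_block[where L = L, OF IH]) (use L c sub s in simp_all)
  have m: "mset ([i, ?j] @ v) = ?M" "mset ([i] @ (?j # v)) = ?M" "mset ([?j] @ (v @ [i])) = ?M"
    by simp_all
  define X Y Z where XYZ: "X = xw (i # ?j # v)" "Y = xw (?j # v @ [i])" "Z = xw (v @ [i, ?j])"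
  have 1: "X - fscale ?p Z \<in> lie_comp ?M" using 1 unfolding m XYZ by simp
  have 2: "X - fscale ?a Y \<in> lie_comp ?M" using 2 unfolding m XYZ by simp
  have 3: "Y - fscale ?b Z \<in> lie_comp ?M" using 3 unfolding m XYZ by simp
  have ab: "?a * ?b = inverse q * ?p"
  proof -
    have "?a = qm i ?j * bich [i] v"
      using bich_simps(5)[of "[i]" "[?j]" v] by simp
    then have e: "?a * ?b = (qm i ?j * qm ?j i) * (bich [i] v * bich [?j] v)"
      by simp
    have "qm i ?j * qm ?j i = inverse q" using adj[of i] sub by simp
    then show ?thesis unfolding e by simp
  qed
  \<comment> \<open>This combination eliminates \<open>X\<close> and \<open>Y\<close>; what remains
    is \<open>Z\<close> times \<open>1 - inverse q\<close> times a nonzero bicharacter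
    value.\<close>
  have "(X - fscale ?a Y) + fscale ?a (Y - fscale ?b Z) - (X - fscale ?p Z) \<in> lie_comp ?M"
    by (rule lie_comp_closed(4)[OF lie_comp_closed(3)[OF 2 lie_comp_closed(2)[OF 3]] 1])
  also have "(X - fscale ?a Y) + fscale ?a (Y - fscale ?b Z) - (X - fscale ?p Z) = fscale (?p - ?a * ?b) Z"
    by (simp add: fs.scale_right_diff_distrib fs.scale_left_diff_distrib)
  also have "?p - ?a * ?b = (1 - inverse q) * ?p" unfolding ab by (simp add: algebra_simps)
  finally have "Z \<in> lie_comp ?M"
    by (rule lie_comp_scaleD) (use bich_nz[of "[i, ?j]" v] sub in simp)
  from lie_comp_closed(3)[OF 1 lie_comp_closed(2)[OF this, of ?p]] have "X \<in> lie_comp ?M"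
    by (simp only: diff_add_cancel)
  then show ?thesis unfolding XYZ(1) .
qed

text \<open>It suffices to bring some \<open>a\<close> directly in front of some
  \<open>Suc a\<close>. Taking \<open>a\<close> minimal guarantees that every letter other than
  these two is at least \<open>a + 2\<close> and so commutes with \<open>a\<close> up to a
  scalar.\<close>

lemma xw_lie_comp:
  assumes "conn (set w)" "set w \<subseteq> {1..n}"
  shows "xw w \<in> lie_comp (mset w)"
  using assms
proof (induction "length w" arbitrary: w rule: less_induct)
  case less
  note IH = less.hyps
  note c = less.prems
  define a where "a = Min (set w)"
  have ne: "w \<noteq> []" using c(1) by (auto simp: conn_def)
  have aw: "a \<in> set w" and amin: "x \<in> set w \<Longrightarrow> a \<le> x" for x using ne by (auto simp: a_def)
  have a1: "a \<in> {1..n}" using aw c by auto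
  show ?case
  proof (cases "set w = {a}")
    case True
    then have wk: "w = replicate (length w) a" by (metis replicate_length_same singletonD)
    define k where "k = length w"
    with wk have wk: "w = replicate k a" by simp
    have "k \<noteq> 0" using ne wk by auto
    \<comment> \<open>A generator, a vanishing power, or a power obtained as the bracket of one
      letter with \<open>k - 1\<close> copies of itself. The last has factor
      \<open>1 - q ^ (k - 1)\<close>, nonzero since \<open>0 < k - 1 < N\<close>.\<close>
    then consider "k = 1" | "k > N" | "2 \<le> k" "k \<le> N" by linarith
    then show ?thesis
    proof cases
      case 1
      have "letter a \<in> lie_comp {#a#}" unfolding lie_comp_def
        by (rule fs.span_base) (auto intro!: image_eqI[of _ _ "Lf a"])
      then show ?thesis by (simp add: wk 1)
    next
      case 2
      then show ?thesis using letter_power_N[OF a1, of k] wk by simp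
    next
      case 3
      obtain m where km: "k = Suc m" using 3(1) by (cases k) auto
      have k: "w = [a] @ replicate (k - 1) a" "w = replicate (k - 1) a @ [a]"
        using wk by (simp_all add: km replicate_append_same)
      have b: "bich [a] (replicate m a) = q ^ m" for m
        by (simp add: bich_replicate diag[OF a1])
      have "xw ([a] @ replicate (k - 1) a) - fscale (bich [a] (replicate (k - 1) a)) (xw (replicate (k - 1) a @ [a]))
          \<in> lie_comp (mset ([a] @ replicate (k - 1) a))"
        by (rule rotate_block[where L = "length w", OF IH]) (use c wk km in simp_all)
      then have "fscale (1 - q ^ (k - 1)) (xw w) \<in> lie_comp (mset w)"
        unfolding k(1)[symmetric] k(2)[symmetric] b by (simp add: fs.scale_left_diff_distrib)
      then show ?thesis
        by (rule lie_comp_scaleD) (use qord[of "k - 1"] 3 in simp)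
    qed
  next
    case False
    then obtain z where "z \<in> set w" "z \<noteq> a" using aw by auto
    then have sa: "Suc a \<in> set w"
      using connD[OF c(1) aw, of z "Suc a"] amin[of z] by simp
    obtain p r where pr: "w = p @ a # r" using aw by (meson split_list)
    have "Suc a \<in> set (r @ p)" using sa pr by auto
    \<comment> \<open>Reading cyclically from an \<open>a\<close>, one stops at the next
      \<open>Suc a\<close> and takes the last \<open>a\<close> before it. The stretch
      \<open>s\<close> between them contains neither letter, so this \<open>a\<close> can be moved
      across it.\<close>
    then obtain s0 t0 where st0: "r @ p = s0 @ Suc a # t0" "Suc a \<notin> set s0"
      using split_list_first by metis
    obtain p' s where ps: "a # s0 = p' @ a # s" "a \<notin> set s"
      using split_list_last[of a "a # s0"] by auto
    have ss0: "set s \<subseteq> set s0" using ps(1) by (cases p') auto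
    have "mset (r @ p) = mset (s0 @ Suc a # t0)" using st0 by simp
    then have mw: "mset w = mset (a # s0) + mset (Suc a # t0)" unfolding pr by (simp add: ac_simps)
    have mw': "mset w = mset (p' @ a # s) + mset (Suc a # t0)" using mw unfolding ps(1) .
    let ?t = "t0 @ p'"
    have m: "mset (a # Suc a # ?t @ s) = mset w" using mw' by simp
    have set_eq: "set (a # Suc a # ?t @ s) = set w" using m by (rule mset_eq_setD)
    have "xw (a # Suc a # (?t @ s)) \<in> lie_comp (mset (a # Suc a # ?t @ s))"
      by (rule xw_adjacent_lie_comp[where L = "length w", OF IH])
        (use c set_eq arg_cong[OF m, of size] in auto)
    then have 1: "xw ((a # Suc a # ?t) @ s) \<in> lie_comp (mset w)" unfolding m by simp
    have 2: "xw (s @ (a # Suc a # ?t)) \<in> lie_comp (mset w)"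
    proof (rule rotate_letters[OF IH _ c 1])
      have "mset w = mset ((a # Suc a # ?t) @ s)" using m by simp
      also have "\<dots> = mset (s @ (a # Suc a # ?t))" unfolding mset_append by (rule add.commute)
      finally show "mset w = mset (s @ (a # Suc a # ?t))" .
    qed
    have "sep [a] s"
    proof -
      have "commuting a x" if "x \<in> set s" for x
      proof -
        have "x \<noteq> a" "x \<noteq> Suc a" using that ps(2) ss0 st0(2) by auto
        moreover have "x \<in> set w" using that set_eq by auto
        ultimately show ?thesis using a1 amin[of x] c by (intro commuting_far) auto
      qed
      then show ?thesis by (simp add: sep_def)
    qed
    then have "letter a \<star> xw s = fscale (bich [a] s) (xw s \<star> letter a)" by (rule letter_xw_commute)
    then have "xw (a # s @ Suc a # ?t) = fscale (bich [a] s) (xw (s @ (a # Suc a # ?t)))"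
      by (simp add: xw_append flip: mul_assoc)
    then have "xw ((a # s @ Suc a # t0) @ p') \<in> lie_comp (mset w)" using 2 by simp
    then have "xw (p' @ (a # s @ Suc a # t0)) \<in> lie_comp (mset w)"
      by (rule rotate_letters[OF IH _ c, rotated -1]) (use mw' in \<open>simp_all add: ac_simps\<close>)
    also have "p' @ (a # s @ Suc a # t0) = (a # r) @ p" using ps(1) st0(1) by simp
    finally have "xw (p @ (a # r)) \<in> lie_comp (mset w)"
      by (rule rotate_letters[OF IH _ c, rotated -1]) (use pr in \<open>simp_all add: ac_simps\<close>)
    then show ?thesis by (simp add: pr)
  qed
qed

text \<open>If both factors are nonzero, their supports are connected by induction. A disconnected
  union then forces all letters of one to be at distance at least two from those of the other, by
  \<open>conn_Un\<close>, and the factors commute with exactly the scalar that the bracket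
  subtracts.\<close>

lemma beval_cases:
  assumes "set (letters t) \<subseteq> {1..n}"
  shows "beval qm t \<in> fs.span (xw ` {w. mset w = mset (letters t)}) \<and> (beval qm t = 0 \<or> conn (set (letters t)))"
  using assms
proof (induction t)
  case (Lf i)
  have "letter i \<in> xw ` {w. mset w = {#i#}}" by (auto intro!: image_eqI[of _ _ "[i]"])
  then show ?case by (auto intro!: fs.span_base simp: conn_def)
next
  case (Br s t)
  let ?S = "xw ` {w. mset w = mset (letters s)}" and ?T = "xw ` {w. mset w = mset (letters t)}"
    and ?ST = "xw ` {w. mset w = mset (letters (Br s t))}"
  have st: "beval qm s \<in> fs.span ?S" "beval qm t \<in> fs.span ?T"
    "beval qm s = 0 \<or> conn (set (letters s))" "beval qm t = 0 \<or> conn (set (letters t))"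
    and sub: "set (letters s) \<subseteq> {1..n}" "set (letters t) \<subseteq> {1..n}" using Br by auto
  define F where "F = (\<lambda>f g. g \<star> f - fscale (chi qm t s) (f \<star> g))"
  have e: "beval qm (Br s t) = F (beval qm s) (beval qm t)" by (simp add: F_def fscale_def)
  have F: "F (x + y) z = F x z + F y z" "F (fscale c x) z = fscale c (F x z)"
    "F z (x + y) = F z x + F z y" "F z (fscale c x) = fscale c (F z x)" for x y z c
    by (auto simp: F_def fs.scale_right_distrib fs.scale_right_diff_distrib mult.commute)
  have 1: "F (beval qm s) (beval qm t) \<in> fs.span ?ST"
  proof (rule span_bilinear_image[of F, OF F _ st(1,2)])
    fix x y assume "x \<in> ?S" "y \<in> ?T"
    then obtain u v where "x = xw u" "y = xw v" "mset u = mset (letters s)" "mset v = mset (letters t)" by auto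
    then show "F x y \<in> fs.span ?ST" unfolding F_def
      by (intro fs.span_diff fs.span_scale fs.span_base) (auto simp flip: xw_append)
  qed
  have "F (beval qm s) (beval qm t) = 0" if nc: "\<not> conn (set (letters (Br s t)))" "beval qm s \<noteq> 0" "beval qm t \<noteq> 0"
  proof -
    have far: "commuting y x" if "x \<in> set (letters s)" "y \<in> set (letters t)" for x y
      using conn_Un[of "set (letters s)" "set (letters t)" x y] st nc that sub
      by (intro commuting_far) fastforce+
    have "F (beval qm s) (beval qm t) \<in> fs.span {}"
    proof (rule span_bilinear_image[of F, OF F _ st(1,2)])
      fix x y assume "x \<in> ?S" "y \<in> ?T"
      then obtain u v where uv: "x = xw u" "y = xw v" "mset u = mset (letters s)" "mset v = mset (letters t)" by auto
      have "sep v u" using far mset_eq_setD[OF uv(3)] mset_eq_setD[OF uv(4)] by (auto simp: sep_def)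
      from xw_commute[OF this] have "F x y = 0"
        unfolding F_def uv chi_eq_bich using bich_perm[OF uv(4,3)] by (simp flip: xw_append)
      then show "F x y \<in> fs.span {}" by (simp add: fs.span_zero)
    qed
    then show ?thesis by simp
  qed
  moreover have "F (beval qm s) (beval qm t) = 0" if "beval qm s = 0 \<or> beval qm t = 0"
    using that by (auto simp: F_def)
  ultimately show ?case using 1 unfolding e by blast
qed

lemma nichols_lie_eq: "nichols_lie n qm = fs.span (xw ` {w. conn (set w) \<and> set w \<subseteq> {1..n}})"
proof -
  have "beval qm t \<in> fs.span (xw ` {w. conn (set w) \<and> set w \<subseteq> {1..n}})" if "set (letters t) \<subseteq> {1..n}" for t
  proof (cases "beval qm t = 0")
    case False
    then have b: "beval qm t \<in> fs.span (xw ` {w. mset w = mset (letters t)})" "conn (set (letters t))"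
      using beval_cases[OF that] by auto
    have "{w. mset w = mset (letters t)} \<subseteq> {w. conn (set w) \<and> set w \<subseteq> {1..n}}"
    proof
      fix w assume "w \<in> {w. mset w = mset (letters t)}"
      then have "set w = set (letters t)" using mset_eq_setD by blast
      then show "w \<in> {w. conn (set w) \<and> set w \<subseteq> {1..n}}" using b that by simp
    qed
    then have "fs.span (xw ` {w. mset w = mset (letters t)}) \<subseteq> fs.span (xw ` {w. conn (set w) \<and> set w \<subseteq> {1..n}})"
      by (intro fs.span_mono image_mono)
    then show ?thesis using b(1) by (rule subsetD)
  qed (simp add: fs.span_zero)
  moreover have "xw w \<in> fs.span (beval qm ` {t. set (letters t) \<subseteq> {1..n}})"
    if w: "conn (set w)" "set w \<subseteq> {1..n}" for w
  proof -
    have "{t. mset (letters t) = mset w} \<subseteq> {t. set (letters t) \<subseteq> {1..n}}"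
      using w(2) mset_eq_setD by blast
    then have "lie_comp (mset w) \<subseteq> fs.span (beval qm ` {t. set (letters t) \<subseteq> {1..n}})"
      unfolding lie_comp_def by (intro fs.span_mono image_mono)
    then show ?thesis using xw_lie_comp[OF w] by (rule subsetD)
  qed
  ultimately show ?thesis unfolding nichols_lie_def
    by (intro equalityI fs.span_minimal fs.subspace_span) auto
qed

end

section \<open>Dimensions and root vectors\<close>

text \<open>Indexing by a family makes distinctness of the vectors a consequence of independence, so
  that products of basis vectors can be counted by their indices.\<close>

definition indep_fam :: "'i set \<Rightarrow> ('i \<Rightarrow> nat list \<Rightarrow> 'a::field) \<Rightarrow> bool" where
  "indep_fam I g \<longleftrightarrow> (\<forall>c. (\<Sum>i\<in>I. fscale (c i) (g i)) = 0 \<longrightarrow> (\<forall>i\<in>I. c i = 0))"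

lemma indep_famD: "indep_fam I g \<Longrightarrow> (\<Sum>i\<in>I. fscale (c i) (g i)) = 0 \<Longrightarrow> i \<in> I \<Longrightarrow> c i = 0"
  unfolding indep_fam_def by blast

text \<open>Unlike \<open>vector_space.dim\<close>, this implies that the space is finite-dimensional.\<close>

definition has_dim :: "(nat list \<Rightarrow> 'a::field) set \<Rightarrow> nat \<Rightarrow> bool" where
  "has_dim U d \<longleftrightarrow> (\<exists>B. finite B \<and> fs.independent B \<and> fs.span B = U \<and> card B = d)"

lemma has_dim_dim: "has_dim U d \<Longrightarrow> fs.dim U = d"
  unfolding has_dim_def using fs.dim_span_eq_card_independent by blast

lemma has_dimI:
  fixes g :: "'i \<Rightarrow> nat list \<Rightarrow> 'a::field"
  assumes fin: "finite I" and ind: "indep_fam I g" and sp: "fs.span (g ` I) = U"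
  shows "has_dim U (card I)"
proof -
  have inj: "inj_on g I"
  proof (rule inj_onI, rule ccontr)
    fix i j assume ij: "i \<in> I" "j \<in> I" "g i = g j" "i \<noteq> j"
    define c where "c = (\<lambda>k. if k = i then 1 else if k = j then - 1 else (0::'a))"
    have "(\<Sum>k\<in>I. fscale (c k) (g k)) = (\<Sum>k\<in>{i, j}. fscale (c k) (g k))"
      using fin ij by (intro sum.mono_neutral_right) (auto simp: c_def)
    also have "\<dots> = 0" using ij by (simp add: c_def)
    finally have "c i = 0" by (rule indep_famD[OF ind _ ij(1)])
    then show False by (simp add: c_def)
  qed
  have "fs.independent (g ` I)"
  proof
    assume "fs.dependent (g ` I)"
    then obtain u v where u: "(\<Sum>x\<in>g ` I. fscale (u x) x) = 0" "v \<in> g ` I" "u v \<noteq> 0"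
      using fs.dependent_finite[of "g ` I"] fin by auto
    then have "(\<Sum>i\<in>I. fscale (u (g i)) (g i)) = 0" by (simp add: sum.reindex[OF inj])
    then have "\<forall>i\<in>I. u (g i) = 0" using indep_famD[OF ind, of "\<lambda>i. u (g i)"] by blast
    then show False using u by auto
  qed
  moreover have "card (g ` I) = card I" using inj by (rule card_image)
  ultimately show ?thesis unfolding has_dim_def using fin sp by blast
qed

lemma has_dimE:
  assumes "has_dim U d"
  obtains B where "finite B" "indep_fam B (\<lambda>b. b)" "fs.span B = U" "card B = d"
proof -
  obtain B where B: "finite B" "fs.independent B" "fs.span B = U" "card B = d"
    using assms unfolding has_dim_def by blast
  have "indep_fam B (\<lambda>b. b)"
    unfolding indep_fam_def using fs.dependent_finite[OF B(1)] B(2) by auto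
  then show ?thesis using B that by blast
qed

lemma has_dim_subspace:
  assumes "has_dim U d" "fs.subspace V" "V \<subseteq> U"
  shows "has_dim V (fs.dim V)"
proof -
  obtain T where T: "finite T" "fs.span T = U" using assms(1) unfolding has_dim_def by blast
  obtain B where B: "B \<subseteq> V" "fs.independent B" "V \<subseteq> fs.span B" "card B = fs.dim V"
    by (rule fs.basis_exists)
  have "finite B" using fs.independent_span_bound[OF T(1) B(2)] B(1) assms(3) T(2) by blast
  moreover have "fs.span B = V" using B assms(2) by (simp add: fs.span_subspace)
  ultimately show ?thesis unfolding has_dim_def using B by blast
qed

lemma has_dim_direct_sum:
  fixes U V :: "(nat list \<Rightarrow> 'a::field) set"
  assumes "has_dim U d" "has_dim V e" "U \<inter> V = {0}"
  shows "has_dim (fs.span (U \<union> V)) (d + e)"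
proof -
  obtain B where B: "finite B" "indep_fam B (\<lambda>b. b)" "fs.span B = U" "card B = d"
    using assms(1) by (rule has_dimE)
  obtain C where C: "finite C" "indep_fam C (\<lambda>b. b)" "fs.span C = V" "card C = e"
    using assms(2) by (rule has_dimE)
  let ?I = "B <+> C" and ?g = "case_sum (\<lambda>b. b) (\<lambda>c. c)"
  have img: "?g ` ?I = B \<union> C" by (simp add: Plus_def image_Un image_image)
  have "indep_fam ?I ?g"
    unfolding indep_fam_def
  proof (intro allI impI)
    fix c :: "(nat list \<Rightarrow> 'a) + (nat list \<Rightarrow> 'a) \<Rightarrow> 'a"
    assume "(\<Sum>i\<in>?I. fscale (c i) (?g i)) = 0"
    then have s: "(\<Sum>b\<in>B. fscale (c (Inl b)) b) + (\<Sum>b\<in>C. fscale (c (Inr b)) b) = 0"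
      by (simp add: sum.Plus B C)
    have u: "(\<Sum>b\<in>B. fscale (c (Inl b)) b) \<in> U"
      unfolding B(3)[symmetric] by (intro fs.span_sum fs.span_scale fs.span_base)
    have v: "(\<Sum>b\<in>C. fscale (c (Inr b)) b) \<in> V"
      unfolding C(3)[symmetric] by (intro fs.span_sum fs.span_scale fs.span_base)
    have "(\<Sum>b\<in>B. fscale (c (Inl b)) b) = - (\<Sum>b\<in>C. fscale (c (Inr b)) b)"
      using s by (simp add: eq_neg_iff_add_eq_0)
    also have "\<dots> \<in> V" using v unfolding C(3)[symmetric] by (rule fs.span_neg)
    finally have z: "(\<Sum>b\<in>B. fscale (c (Inl b)) b) = 0" using u assms(3) by blast
    then have "(\<Sum>b\<in>C. fscale (c (Inr b)) b) = 0" using s by simp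
    then have "\<forall>b\<in>C. c (Inr b) = 0" using indep_famD[OF C(2), of "\<lambda>b. c (Inr b)"] by blast
    moreover have "\<forall>b\<in>B. c (Inl b) = 0" using z indep_famD[OF B(2), of "\<lambda>b. c (Inl b)"] by blast
    ultimately show "\<forall>i\<in>?I. c i = 0" by auto
  qed
  moreover have "fs.span (?g ` ?I) = fs.span (U \<union> V)"
    unfolding img B(3)[symmetric] C(3)[symmetric]
  proof (rule antisym)
    show "fs.span (B \<union> C) \<subseteq> fs.span (fs.span B \<union> fs.span C)"
      by (intro fs.span_mono Un_mono fs.span_superset)
    have "fs.span B \<union> fs.span C \<subseteq> fs.span (B \<union> C)"
      using fs.span_mono[of B "B \<union> C"] fs.span_mono[of C "B \<union> C"] by auto
    then show "fs.span (fs.span B \<union> fs.span C) \<subseteq> fs.span (B \<union> C)"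
      by (rule fs.span_minimal) (rule fs.subspace_span)
  qed
  ultimately have "has_dim (fs.span (U \<union> V)) (card ?I)"
    using B(1) C(1) by (intro has_dimI) auto
  then show ?thesis using B C by (simp add: card_Plus)
qed

section \<open>Root vectors and the operators dual to them\<close>

definition root_word :: "nat \<Rightarrow> nat \<Rightarrow> nat list" where
  "root_word t j = rev [j..<Suc t]"

text \<open>A multiple of the root vector of the interval \<open>{j..t}\<close>.\<close>

definition root_vec :: "nat \<Rightarrow> nat \<Rightarrow> nat list \<Rightarrow> 'a::comm_ring_1" where
  "root_vec t j = delta (root_word t j)"

lemma root_word_rec: "j \<le> t \<Longrightarrow> root_word t j = root_word t (Suc j) @ [j]"
  by (simp add: root_word_def upt_conv_Cons del: upt_Suc)

lemma root_word_Nil [simp]: "root_word t (Suc t) = []"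
  by (simp add: root_word_def)

lemma set_root_word: "set (root_word t j) = {j..t}"
  by (auto simp: root_word_def)

lemma Y_top: "root_vec t (Suc t) = delta []" "root_vec t t = letter t"
  by (simp_all add: root_vec_def root_word_rec letter_eq_delta)

text \<open>The descending order of \<open>root_word\<close> is what makes this work: deleting the
  last letter shortens \<open>{j..t}\<close> at its lower end and stays within the family with the
  same \<open>t\<close>.\<close>

lemma rd_root_vec: "rd i (root_vec t j :: nat list \<Rightarrow> 'a::field) = (if i = j \<and> j \<le> t then root_vec t (Suc j) else 0)"
proof (cases "j \<le> t")
  case True
  then show ?thesis by (simp add: root_vec_def root_word_rec)
next
  case False
  then have "root_word t j = []" by (simp add: root_word_def)
  then show ?thesis using False by (simp add: root_vec_def)
qed

lemma Y_at_Nil: "j \<le> t \<Longrightarrow> root_vec t j [] = 0"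
  by (simp add: root_vec_def delta_def root_word_rec)

context quantum_shuffle
begin

definition alph_span :: "nat set \<Rightarrow> (nat list \<Rightarrow> 'a) set" where
  "alph_span S = fs.span (xw ` {w. set w \<subseteq> S})"

primrec pw :: "(nat list \<Rightarrow> 'a) \<Rightarrow> nat \<Rightarrow> nat list \<Rightarrow> 'a" where
  "pw f 0 = delta []"
| "pw f (Suc m) = f \<star> pw f m"

lemma pw_commute_scaled:
  assumes "f \<star> g = fscale c (g \<star> f)"
  shows "f \<star> pw g m = fscale (c ^ m) (pw g m \<star> f)"
proof (induction m)
  case (Suc m)
  have "f \<star> pw g (Suc m) = (f \<star> g) \<star> pw g m" by (simp add: mul_assoc)
  also have "\<dots> = fscale c (g \<star> (f \<star> pw g m))" by (simp add: assms mul_assoc)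
  also have "\<dots> = fscale (c ^ Suc m) (pw g (Suc m) \<star> f)" by (simp add: Suc mul_assoc)
  finally show ?case .
qed simp

lemma tw_pw: "tw v f = fscale c f \<Longrightarrow> tw v (pw f m) = fscale (c ^ m) (pw f m)"
  by (induction m) (auto simp: tw_mul mult.commute)

lemma alph_span_one: "delta [] \<in> alph_span S"
  unfolding alph_span_def by (rule fs.span_base) (auto intro!: image_eqI[of _ _ "[]"])

lemma letter_alph_span: "i \<in> S \<Longrightarrow> letter i \<in> alph_span S"
  unfolding alph_span_def by (rule fs.span_base) (auto intro!: image_eqI[of _ _ "[i]"])

lemma alph_span_mul: "f \<in> alph_span S \<Longrightarrow> g \<in> alph_span S \<Longrightarrow> f \<star> g \<in> alph_span S"
  unfolding alph_span_def
  by (rule span_bilinear_image[of "(\<star>)"]) (auto intro!: fs.span_base simp flip: xw_append)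

lemma alph_span_closed: "f \<in> alph_span S \<Longrightarrow> g \<in> alph_span S \<Longrightarrow> f - g \<in> alph_span S" "f \<in> alph_span S \<Longrightarrow> fscale c f \<in> alph_span S"
  "f \<in> alph_span S \<Longrightarrow> g \<in> alph_span S \<Longrightarrow> f + g \<in> alph_span S" "0 \<in> alph_span S"
  by (auto simp: alph_span_def fs.span_diff fs.span_scale fs.span_add fs.span_zero)

lemma xw_alph_span: "set w \<subseteq> S \<Longrightarrow> xw w \<in> alph_span S"
  unfolding alph_span_def by (rule fs.span_base) auto

lemma alph_span_linear_image:
  assumes "\<And>x y. F (x + y) = F x + F y" "\<And>c x. F (fscale c x) = fscale c (F x)"
    and "\<And>w. set w \<subseteq> S \<Longrightarrow> F (xw w) \<in> fs.span C" and f: "f \<in> alph_span S"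
  shows "F f \<in> fs.span C"
  by (rule span_linear_image[of F, OF assms(1,2) _ f[unfolded alph_span_def]]) (use assms(3) in auto)

lemma tw_alph_span:
  assumes "f \<in> alph_span S" shows "tw v f \<in> alph_span S"
  unfolding alph_span_def[of S]
proof (rule alph_span_linear_image[OF _ _ _ assms])
  fix w :: "nat list" assume "set w \<subseteq> S"
  then show "tw v (xw w) \<in> fs.span (xw ` {w. set w \<subseteq> S})"
    unfolding tw_xw by (intro fs.span_scale fs.span_base) simp
qed simp_all

lemma rd_alph_span:
  assumes "f \<in> alph_span S" shows "rd i f \<in> alph_span S"
proof -
  have "rd i (xw w) \<in> alph_span S" if "set w \<subseteq> S" for w
    using that
  proof (induction w)
    case (Cons j w)
    then have "letter j \<in> alph_span S" "xw w \<in> alph_span S"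
      using letter_alph_span xw_alph_span by auto
    then show ?case using Cons by (auto simp: rd_mul intro!: alph_span_closed alph_span_mul tw_alph_span)
  qed (simp add: alph_span_closed)
  then show ?thesis
    unfolding alph_span_def[of S] by - (rule alph_span_linear_image[where F = "rd i", OF _ _ _ assms], simp_all)
qed

lemma rd_alph_span_zero:
  assumes f: "f \<in> alph_span S" and i: "i \<notin> S"
  shows "rd i f = 0"
proof -
  have "rd i (xw w) = 0" if "set w \<subseteq> S" for w
    using that i by (induction w) (auto simp: rd_mul)
  then have "rd i f \<in> fs.span {}"
    by - (rule alph_span_linear_image[where F = "rd i", OF _ _ _ f], simp_all)
  then show ?thesis by simp
qed

lemma alph_span_support: "f \<in> alph_span S \<Longrightarrow> f w \<noteq> 0 \<Longrightarrow> set w \<subseteq> S"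
proof (induction w arbitrary: f rule: rev_induct)
  case (snoc i w)
  have nz: "rd i f w \<noteq> 0" using snoc.prems by (simp add: rd_def)
  then have "rd i f \<noteq> 0" by (auto simp: fun_apply)
  then have "i \<in> S" using rd_alph_span_zero[OF snoc.prems(1)] by blast
  moreover have "set w \<subseteq> S" using nz by (rule snoc.IH[OF rd_alph_span[OF snoc.prems(1)]])
  ultimately show ?case by simp
qed simp

lemma tw_root_vec: "tw v (root_vec t j) = fscale (bich v (root_word t j)) (root_vec t j)"
  by (simp add: root_vec_def)

abbreviation root_bich :: "nat \<Rightarrow> nat \<Rightarrow> nat \<Rightarrow> 'a" where "root_bich t i j \<equiv> bich [i] (root_word t j)"

lemma B_rec: "j \<le> t \<Longrightarrow> root_bich t i j = qm i j * root_bich t i (Suc j)"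
  by (simp add: root_word_rec)

text \<open>The derivations by \<open>j\<close>, \<open>j + 1\<close>, ..., \<open>t\<close> in this
  order, which strip \<open>root_word t j\<close> from its end. They reduce
  \<open>root_vec t j\<close> to 1 and serve as its dual functional.\<close>

definition chain :: "nat \<Rightarrow> nat \<Rightarrow> (nat list \<Rightarrow> 'a) \<Rightarrow> nat list \<Rightarrow> 'a" where
  "chain t j f = fold rd [j..<Suc t] f"

lemma chain_rec: "j \<le> t \<Longrightarrow> chain t j f = chain t (Suc j) (rd j f)"
  by (simp add: chain_def upt_conv_Cons del: upt_Suc)

lemma chain_top [simp]: "chain t (Suc t) f = f"
  by (simp add: chain_def)

lemma fold_rd_linear:
  "fold rd w (f + g) = fold rd w f + fold rd w g"
  "fold rd w (fscale c f) = fscale c (fold rd w f)" for f g :: "nat list \<Rightarrow> 'a"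
  by (induction w arbitrary: f g) auto

lemma chain_linear [simp]:
  "chain t j (f + g) = chain t j f + chain t j g" "chain t j (fscale c f) = fscale c (chain t j f)"
  by (simp_all add: chain_def fold_rd_linear)

lemma chain_zero [simp]: "chain t j 0 = 0"
  using chain_linear(2)[of t j 0 0] by simp

lemma chain_sum: "chain t j (\<Sum>i\<in>I. f i) = (\<Sum>i\<in>I. chain t j (f i))"
  by (induction I rule: infinite_finite_induct) auto

lemma chain_mul:
  assumes "\<And>i. j \<le> i \<Longrightarrow> i \<le> t \<Longrightarrow> rd i f = 0" "j \<le> Suc t"
  shows "chain t j (f \<star> g) = f \<star> chain t j g"
  using assms(2,1)
proof (induction j arbitrary: g rule: inc_induct)
  case (step j)
  have "chain t j (f \<star> g) = chain t (Suc j) (f \<star> rd j g)"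
    using step by (simp add: chain_rec rd_mul)
  then show ?case using step by (simp add: chain_rec)
qed simp

end

section \<open>Commutation relations of letters and root vectors\<close>

context cartan_A
begin

text \<open>The derivative by \<open>j\<close> returns the claim for \<open>Suc j\<close>, with
  scalars matching because q_ij q_ji = 1; the derivative by \<open>i\<close> yields the bicharacter
  value itself.\<close>

lemma letter_Y_far:
  assumes "1 \<le> i" "t \<le> n" "Suc i < j" "j \<le> Suc t"
  shows "letter i \<star> root_vec t j = fscale (root_bich t i j) (root_vec t j \<star> letter i)"
  using assms(4,3)
proof (induction j rule: inc_induct)
  case base then show ?case by (simp add: Y_top)
next
  case (step j)
  have f: "qm i j * qm j i = 1" using far[of i j] step assms by auto
  have IH: "letter i \<star> root_vec t (Suc j) = fscale (root_bich t i (Suc j)) (root_vec t (Suc j) \<star> letter i)"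
    using step by simp
  show ?case
  proof (rule word_fun_eqI)
    show "(letter i \<star> root_vec t j) [] = fscale (root_bich t i j) (root_vec t j \<star> letter i) []" by (simp add: fun_apply)
    fix k
    show "rd k (letter i \<star> root_vec t j) = rd k (fscale (root_bich t i j) (root_vec t j \<star> letter i))"
      using step f by (auto simp: rd_mul rd_root_vec tw_root_vec IH B_rec mult.assoc[symmetric] mult.commute[of "qm i j"] mult.left_commute)
  qed
qed

text \<open>The coefficients are forced. In the derivative by \<open>Suc i\<close>, the factor
  \<open>q\<close> compensates the symmetrised braiding \<open>inverse q\<close>; the derivative by
  \<open>i\<close> then leaves \<open>1 - q\<close> for the longer root vector. As this is nonzero,
  the relation exhibits \<open>root_vec t i\<close> as a scaled braided commutator.\<close>

lemma letter_Y_pred: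
  assumes "1 \<le> i" "t \<le> n" "Suc i \<le> t"
  shows "letter i \<star> root_vec t (Suc i) = fscale (q * root_bich t i (Suc i)) (root_vec t (Suc i) \<star> letter i)
    + fscale (root_bich t i (Suc i) * (1 - q)) (root_vec t i)"
proof (rule word_fun_eqI)
  show "(letter i \<star> root_vec t (Suc i)) [] = (fscale (q * root_bich t i (Suc i)) (root_vec t (Suc i) \<star> letter i)
    + fscale (root_bich t i (Suc i) * (1 - q)) (root_vec t i)) []"
    using assms by (simp add: fun_apply Y_at_Nil)
  fix k
  let ?j = "Suc i" and ?b = "root_bich t i (Suc (Suc i))"
  have f: "qm i ?j * qm ?j i = inverse q" using adj[of i] assms by auto
  have b: "root_bich t i ?j = qm i ?j * ?b" using B_rec[of ?j t i] assms by simp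
  have e: "q * root_bich t i ?j * qm ?j i = ?b"
  proof -
    have "q * root_bich t i ?j * qm ?j i = q * (qm i ?j * qm ?j i) * ?b" unfolding b by (simp add: ac_simps)
    then show ?thesis unfolding f by simp
  qed
  have F: "letter i \<star> root_vec t (Suc ?j) = fscale ?b (root_vec t (Suc ?j) \<star> letter i)"
    using assms by (intro letter_Y_far) auto
  have c: "q * root_bich t i ?j + root_bich t i ?j * (1 - q) = root_bich t i ?j"
    by (simp add: algebra_simps)
  consider "k = i" | "k = ?j" | "k \<noteq> i" "k \<noteq> ?j" by blast
  then show "rd k (letter i \<star> root_vec t ?j) = rd k (fscale (q * root_bich t i ?j) (root_vec t ?j \<star> letter i)
    + fscale (root_bich t i ?j * (1 - q)) (root_vec t i))"
  proof cases
    case 1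
    then show ?thesis using assms
      by (simp add: rd_mul rd_root_vec tw_root_vec c flip: fs.scale_left_distrib)
  next
    case 2
    then show ?thesis using assms
      by (simp add: rd_mul rd_root_vec F e)
  next
    case 3
    then show ?thesis by (simp add: rd_mul rd_root_vec)
  qed
qed

text \<open>This takes the place of the quantum Serre relation. In the derivative by
  \<open>i\<close>, the correction term with \<open>1 - q\<close> from \<open>letter_Y_pred\<close>
  and the term with \<open>q\<close> from \<open>q_ii\<close> add up to the required scalar.\<close>

lemma letter_Y_same:
  assumes "1 \<le> i" "t \<le> n" "i < t"
  shows "letter i \<star> root_vec t i = fscale (root_bich t i (Suc i)) (root_vec t i \<star> letter i)"
proof (rule word_fun_eqI)
  show "(letter i \<star> root_vec t i) [] = fscale (root_bich t i (Suc i)) (root_vec t i \<star> letter i) []" by (simp add: fun_apply)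
  fix k
  have d: "qm i i = q" using diag assms by auto
  have b: "root_bich t i i = q * root_bich t i (Suc i)" using B_rec[of i t i] assms d by simp
  have P: "letter i \<star> root_vec t (Suc i) = fscale (q * root_bich t i (Suc i)) (root_vec t (Suc i) \<star> letter i)
    + fscale (root_bich t i (Suc i) * (1 - q)) (root_vec t i)"
    using assms by (intro letter_Y_pred) auto
  show "rd k (letter i \<star> root_vec t i) = rd k (fscale (root_bich t i (Suc i)) (root_vec t i \<star> letter i))"
  proof (cases "k = i")
    case True
    have e: "fscale (root_bich t i (Suc i) * (1 - q)) (root_vec t i) + fscale (root_bich t i i) (root_vec t i) = fscale (root_bich t i (Suc i)) (root_vec t i)"
      unfolding b fs.scale_left_distrib[symmetric] by (rule arg_cong2[where f = fscale]) (simp_all add: algebra_simps)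
    have "rd k (letter i \<star> root_vec t i) = fscale (q * root_bich t i (Suc i)) (root_vec t (Suc i) \<star> letter i)
        + (fscale (root_bich t i (Suc i) * (1 - q)) (root_vec t i) + fscale (root_bich t i i) (root_vec t i))"
      using True assms by (simp add: rd_mul rd_root_vec tw_root_vec P add.assoc)
    then show ?thesis unfolding e using True assms
      by (simp add: rd_mul rd_root_vec d fs.scale_right_distrib mult.commute add.commute)
  next
    case False
    then show ?thesis by (simp add: rd_mul rd_root_vec)
  qed
qed

text \<open>Differentiation raises the lower end \<open>j\<close> until it reaches \<open>i\<close>,
  where \<open>letter_Y_same\<close> takes over. At that last step the braiding with the neighbour
  \<open>i - 1\<close> contributes \<open>inverse q\<close>, which cancels against
  \<open>q_ii\<close>.\<close>

lemma letter_Y_inner: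
  assumes "1 \<le> j" "t \<le> n" "j < i" "i < t"
  shows "letter i \<star> root_vec t j = fscale (root_bich t i j) (root_vec t j \<star> letter i)"
proof -
  have "j \<le> i - 1" using assms by simp
  then show ?thesis using assms(1)
  proof (induction j rule: inc_induct)
    case base
    obtain p where i: "i = Suc p" using assms by (cases i) auto
    have p: "1 \<le> p" "Suc p \<le> t" using assms i base by simp_all
    have f: "qm p (Suc p) * qm (Suc p) p = inverse q" using adj[of p] assms p by auto
    have b: "root_bich t i p = qm (Suc p) p * (q * root_bich t i (Suc i))"
      using B_rec[of p t i] B_rec[of i t i] assms diag[of i] i by simp
    have e: "root_bich t i p * qm p i = root_bich t i (Suc i)"
    proof -
      have "root_bich t i p * qm p i = (qm p (Suc p) * qm (Suc p) p) * q * root_bich t i (Suc i)"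
        unfolding b by (simp add: i ac_simps)
      then show ?thesis unfolding f by simp
    qed
    have S: "letter i \<star> root_vec t i = fscale (root_bich t i (Suc i)) (root_vec t i \<star> letter i)"
      using assms by (intro letter_Y_same) auto
    have j: "i - 1 = p" using i by simp
    show ?case unfolding j
    proof (rule word_fun_eqI)
      show "(letter i \<star> root_vec t p) [] = fscale (root_bich t i p) (root_vec t p \<star> letter i) []" by (simp add: fun_apply)
      fix k
      consider "k = i" | "k = p" | "k \<noteq> i" "k \<noteq> p" by blast
      then show "rd k (letter i \<star> root_vec t p) = rd k (fscale (root_bich t i p) (root_vec t p \<star> letter i))"
      proof cases
        case 1
        then have "k \<noteq> p" using i by simp
        with 1 show ?thesis by (simp add: rd_mul rd_root_vec tw_root_vec)
      next
        case 2
        then have "k \<noteq> i" "p \<le> t" using i p by simp_all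
        with 2 show ?thesis by (simp add: rd_mul rd_root_vec S e flip: i)
      next
        case 3
        then show ?thesis by (simp add: rd_mul rd_root_vec)
      qed
    qed
  next
    case (step j)
    have f: "qm i j * qm j i = 1" by (rule far) (use step.hyps assms in auto)
    have IH: "letter i \<star> root_vec t (Suc j) = fscale (root_bich t i (Suc j)) (root_vec t (Suc j) \<star> letter i)"
      using step by simp
    have b: "root_bich t i j = qm i j * root_bich t i (Suc j)" by (rule B_rec) (use step.hyps assms in simp)
    have e: "root_bich t i j * qm j i = root_bich t i (Suc j)"
    proof -
      have "root_bich t i j * qm j i = (qm i j * qm j i) * root_bich t i (Suc j)" unfolding b by (simp add: ac_simps)
      then show ?thesis unfolding f by simp
    qed
    show ?case
    proof (rule word_fun_eqI)
      show "(letter i \<star> root_vec t j) [] = fscale (root_bich t i j) (root_vec t j \<star> letter i) []" by (simp add: fun_apply)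
      fix k
      consider "k = i" | "k = j" | "k \<noteq> i" "k \<noteq> j" by blast
      then show "rd k (letter i \<star> root_vec t j) = rd k (fscale (root_bich t i j) (root_vec t j \<star> letter i))"
      proof cases
        case 1
        then have "k \<noteq> j" using step.hyps by simp
        with 1 show ?thesis by (simp add: rd_mul rd_root_vec tw_root_vec)
      next
        case 2
        then have "k \<noteq> i" "j \<le> t" using assms step.hyps by simp_all
        with 2 show ?thesis by (simp add: rd_mul rd_root_vec IH e)
      next
        case 3
        then show ?thesis by (simp add: rd_mul rd_root_vec)
      qed
    qed
  qed
qed

text \<open>The value \<chi>(e_j + ... + e_{k-1}, e_k + ... + e_t): only the part of the longer
  interval that lies below the shorter one contributes to exchanging their root vectors.\<close>

definition sc :: "nat \<Rightarrow> nat \<Rightarrow> nat \<Rightarrow> 'a" where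
  "sc t j k = bich [j..<k] (root_word t k)"

lemma sc_Suc_left: "j < k \<Longrightarrow> sc t j k = root_bich t j k * sc t (Suc j) k"
  using bich_simps(4)[of "[j]" "[Suc j..<k]" "root_word t k"] by (simp add: sc_def upt_conv_Cons)

text \<open>Within \<open>[j..<k]\<close> only \<open>k - 1\<close> fails to commute with
  \<open>k\<close>, so the symmetrised braiding with \<open>k\<close> is \<open>inverse q\<close>
  and cancels against \<open>q_kk\<close>.\<close>

lemma sc_Suc_right:
  assumes "1 \<le> j" "j < k" "k \<le> t" "t \<le> n"
  shows "sc t j (Suc k) = sc t j k * root_bich t k j"
proof -
  let ?k = "k - 1"
  have k: "Suc ?k = k" using assms by simp
  have u: "[j..<k] = [j..<?k] @ [?k]" using upt_Suc_append[of j ?k] assms k by simp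
  have sep: "sep [j..<?k] [k]" using assms by (auto simp: sep_def intro!: commuting_far)
  have "bich [j..<k] [k] * bich [k] [j..<k] = (bich [j..<?k] [k] * bich [k] [j..<?k]) * (qm ?k k * qm k ?k)"
    unfolding u by (simp add: ac_simps)
  also have "\<dots> = inverse q" using adj[of ?k] assms k bich_sep[OF sep] by simp
  finally have 1: "bich [j..<k] [k] * bich [k] [j..<k] = inverse q" .
  have w: "mset (root_word t j) = mset (root_word t (Suc k) @ k # [j..<k])"
  proof -
    have "[j..<Suc t] = [j..<k] @ k # [Suc k..<Suc t]"
      using assms upt_add_eq_append[of j k "Suc t - k"] by (simp add: upt_conv_Cons del: upt_Suc)
    then show ?thesis by (simp add: root_word_def del: upt_Suc)
  qed
  have "root_bich t k j = bich [k] (root_word t (Suc k)) * (qm k k * bich [k] [j..<k])"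
    using bich_perm[OF refl w, of "[k]"] bich_Cons_right[of "[j..<k]" "[k]" k] u by simp
  also have "qm k k = q" using diag assms by simp
  finally have 2: "root_bich t k j = bich [k] (root_word t (Suc k)) * (q * bich [k] [j..<k])" .
  have 3: "sc t j k = bich [j..<k] (root_word t (Suc k)) * bich [j..<k] [k]"
    using assms by (simp add: sc_def root_word_rec)
  have 4: "sc t j (Suc k) = bich [j..<k] (root_word t (Suc k)) * bich [k] (root_word t (Suc k))"
    using assms by (simp add: sc_def)
  have "sc t j k * root_bich t k j = (bich [j..<k] [k] * bich [k] [j..<k]) * q * sc t j (Suc k)"
    unfolding 2 3 4 by (simp add: ac_simps)
  then show ?thesis unfolding 1 by simp
qed

text \<open>The derivatives by \<open>j\<close> and \<open>k\<close> lead to the pairs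
  \<open>(Suc j, k)\<close> and \<open>(j, Suc k)\<close>, and the two recursions for
  \<open>sc\<close> match the resulting scalars. Allowing \<open>k = Suc t\<close>, where the root
  vector is 1, supplies the end of the induction.\<close>

lemma Y_commute:
  assumes "1 \<le> j" "j < k" "k \<le> Suc t" "t \<le> n"
  shows "root_vec t j \<star> root_vec t k = fscale (sc t j k) (root_vec t k \<star> root_vec t j)"
  using assms(1-3)
proof (induction "(Suc t - j) + (Suc t - k)" arbitrary: j k rule: less_induct)
  case less
  show ?case
  proof (cases "k = Suc t")
    case True
    then show ?thesis by (simp add: Y_top sc_def)
  next
    case False
    then have kt: "k \<le> t" "j \<le> t" using less.prems by auto
    have 1: "root_vec t (Suc j) \<star> root_vec t k = fscale (sc t (Suc j) k) (root_vec t k \<star> root_vec t (Suc j))"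
    proof (cases "Suc j = k")
      case True then show ?thesis by (simp add: sc_def)
    next
      case False
      then show ?thesis using less.prems kt by (intro less.hyps) auto
    qed
    have 2: "root_vec t j \<star> root_vec t (Suc k) = fscale (sc t j (Suc k)) (root_vec t (Suc k) \<star> root_vec t j)"
      using less.prems kt by (intro less.hyps) auto
    show ?thesis
    proof (rule word_fun_eqI)
      show "(root_vec t j \<star> root_vec t k) [] = fscale (sc t j k) (root_vec t k \<star> root_vec t j) []"
        using kt by (simp add: fun_apply Y_at_Nil)
      fix i
      consider "i = j" | "i = k" | "i \<noteq> j" "i \<noteq> k" by blast
      then show "rd i (root_vec t j \<star> root_vec t k) = rd i (fscale (sc t j k) (root_vec t k \<star> root_vec t j))"
      proof cases
        case 1
        then have "i \<noteq> k" using less.prems by simp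
        with 1 show ?thesis
          using kt less.prems by (simp add: rd_mul rd_root_vec tw_root_vec \<open>root_vec t (Suc j) \<star> root_vec t k = _\<close> sc_Suc_left)
      next
        case 2
        then have "i \<noteq> j" using less.prems by simp
        with 2 show ?thesis
          using kt less.prems assms(4) by (simp add: rd_mul rd_root_vec tw_root_vec \<open>root_vec t j \<star> root_vec t (Suc k) = _\<close> sc_Suc_right)
      next
        case 3 then show ?thesis by (simp add: rd_mul rd_root_vec)
      qed
    qed
  qed
qed

text \<open>Each factor differentiated leaves \<open>root_vec t (Suc j)\<close>, which must be
  carried to the front. Carrying it past one \<open>root_vec t j\<close> costs
  \<open>inverse q\<close> more than the twist does, so the terms sum to a quantum integer at
  \<open>inverse q\<close>.\<close>

lemma rd_pw_Y:
  assumes "1 \<le> j" "j \<le> t" "t \<le> n"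
  shows "rd i (pw (root_vec t j) (Suc m)) = (if i = j then
    fscale (root_bich t j j ^ m * (\<Sum>a<Suc m. inverse q ^ a)) (root_vec t (Suc j) \<star> pw (root_vec t j) m) else 0)"
proof (induction m)
  case 0
  show ?case using assms by (simp add: rd_root_vec)
next
  case (Suc m)
  let ?root_vec = "root_vec t j" and ?b = "root_bich t j j"
  have b: "sc t j (Suc j) = ?b * inverse q"
    using B_rec[of j t j] diag[of j] assms by (simp add: sc_def)
  have c: "?root_vec \<star> root_vec t (Suc j) = fscale (?b * inverse q) (root_vec t (Suc j) \<star> ?root_vec)"
    using Y_commute[of j "Suc j" t] assms b by simp
  show ?case
  proof (cases "i = j")
    case True
    let ?s = "\<Sum>a<Suc m. inverse q ^ a"
    have "rd j (pw ?root_vec (Suc (Suc m))) = ?root_vec \<star> rd j (pw ?root_vec (Suc m)) + root_vec t (Suc j) \<star> tw [j] (pw ?root_vec (Suc m))"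
      using assms by (simp only: pw.simps rd_mul rd_root_vec if_True simp_thms)
    also have "?root_vec \<star> rd j (pw ?root_vec (Suc m)) = fscale (?b ^ m * ?s) ((?root_vec \<star> root_vec t (Suc j)) \<star> pw ?root_vec m)"
      using Suc True by (simp add: mul_assoc del: pw.simps)
    also have "\<dots> = fscale (?b ^ m * ?s * (?b * inverse q)) (root_vec t (Suc j) \<star> pw ?root_vec (Suc m))"
      by (simp add: c mul_assoc)
    also have "tw [j] (pw ?root_vec (Suc m)) = fscale (?b ^ Suc m) (pw ?root_vec (Suc m))"
      by (rule tw_pw) (rule tw_root_vec)
    also have "fscale (?b ^ m * ?s * (?b * inverse q)) (root_vec t (Suc j) \<star> pw ?root_vec (Suc m)) + root_vec t (Suc j) \<star> fscale (?b ^ Suc m) (pw ?root_vec (Suc m))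
      = fscale (?b ^ m * ?s * (?b * inverse q) + ?b ^ Suc m) (root_vec t (Suc j) \<star> pw ?root_vec (Suc m))"
      by (simp add: fs.scale_left_distrib del: pw.simps)
    also have "?b ^ m * ?s * (?b * inverse q) + ?b ^ Suc m = ?b ^ Suc m * (\<Sum>a<Suc (Suc m). inverse q ^ a)"
      unfolding sum.lessThan_Suc_shift[of _ "Suc m"] by (simp add: sum_distrib_left sum_distrib_right algebra_simps del: sum.lessThan_Suc)
    finally show ?thesis using True by simp
  next
    case False
    then show ?thesis using Suc by (simp add: rd_mul rd_root_vec)
  qed
qed

lemma sum_inverse_q:
  shows "(\<Sum>a<N. inverse q ^ a) = 0" and "0 < m \<Longrightarrow> m < N \<Longrightarrow> (\<Sum>a<m. inverse q ^ a) \<noteq> 0"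
proof -
  have ne: "inverse q \<noteq> 1" by simp
  show "(\<Sum>a<N. inverse q ^ a) = 0" using geometric_sum[OF ne, of N] qN by (simp add: power_inverse)
  assume "0 < m" "m < N"
  then show "(\<Sum>a<m. inverse q ^ a) \<noteq> 0"
    using geometric_sum[OF ne, of m] qord[of m] ne by (simp add: power_inverse)
qed

lemma pw_Y_N:
  assumes "1 \<le> j" "j \<le> t" "t \<le> n"
  shows "pw (root_vec t j) N = 0"
proof -
  obtain m where m: "N = Suc m" using N by (cases N) auto
  show ?thesis
  proof (rule word_fun_eqI)
    show "pw (root_vec t j) N [] = 0 []" using assms by (simp add: m Y_at_Nil fun_apply)
    show "rd i (pw (root_vec t j) N) = rd i 0" for i
      using rd_pw_Y[OF assms, of i m] sum_inverse_q(1) unfolding m by (simp del: pw.simps sum.lessThan_Suc)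
  qed
qed

end

section \<open>The PBW factorization\<close>

context quantum_shuffle
begin

text \<open>Stage \<open>k\<close> consists of ordered products of powers of the root vectors with
  lower ends \<open>a + k - 1\<close>, ..., \<open>a\<close>, followed by an element in the letters
  below \<open>t\<close>. Later root vectors enter on the left, so that the derivations by
  \<open>i \<ge> a + k\<close> never touch those already present.\<close>

primrec pbw_span :: "nat \<Rightarrow> nat \<Rightarrow> nat \<Rightarrow> nat \<Rightarrow> (nat list \<Rightarrow> 'a) set" where
  "pbw_span N a t 0 = alph_span {a..<t}"
| "pbw_span N a t (Suc k) = fs.span {pw (root_vec t (a + k)) m \<star> u | m u. m < N \<and> u \<in> pbw_span N a t k}"

end

locale cartan_A_interval = cartan_A +
  fixes a t :: nat
  assumes a: "1 \<le> a" and a_le_t: "a \<le> t" and tn: "t \<le> n"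
begin

abbreviation G :: "nat \<Rightarrow> (nat list \<Rightarrow> 'a) set" where "G \<equiv> pbw_span N a t"

lemma G_closed: "f \<in> G k \<Longrightarrow> g \<in> G k \<Longrightarrow> f + g \<in> G k" "f \<in> G k \<Longrightarrow> fscale c f \<in> G k" "0 \<in> G k"
  by (cases k; auto simp: alph_span_closed fs.span_add fs.span_scale fs.span_zero)+

lemma G_gen: "m < N \<Longrightarrow> u \<in> G k \<Longrightarrow> pw (root_vec t (a + k)) m \<star> u \<in> G (Suc k)"
  unfolding pbw_span.simps by (rule fs.span_base) blast

lemma G_mono: "G k \<subseteq> G (Suc k)"
proof
  fix u assume "u \<in> G k"
  then show "u \<in> G (Suc k)" using G_gen[of 0 u k] N by simp
qed

lemma G_linear_image:
  assumes "\<And>x y. F (x + y) = F x + F y" "\<And>c x. F (fscale c x) = fscale c (F x)"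
    and gen: "\<And>m u. m < N \<Longrightarrow> u \<in> G k \<Longrightarrow> F (pw (root_vec t (a + k)) m \<star> u) \<in> fs.span C" and f: "f \<in> G (Suc k)"
  shows "F f \<in> fs.span C"
  by (rule span_linear_image[of F, OF assms(1,2) _ f[unfolded pbw_span.simps]]) (use gen in auto)

lemma G_linear_image_G:
  assumes "\<And>x y. F (x + y) = F x + F y" "\<And>c x. F (fscale c x) = fscale c (F x)"
    and gen: "\<And>m u. m < N \<Longrightarrow> u \<in> G k \<Longrightarrow> F (pw (root_vec t (a + k)) m \<star> u) \<in> G (Suc k)" and f: "f \<in> G (Suc k)"
  shows "F f \<in> G (Suc k)"
proof -
  have "F f \<in> fs.span {pw (root_vec t (a + k)) m \<star> u | m u. m < N \<and> u \<in> G k}"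
    by (rule G_linear_image[of F, OF assms(1,2) _ f]) (use gen in auto)
  then show ?thesis by simp
qed

text \<open>A root vector already adjoined either passes the leading power up to a scalar or raises
  its exponent, and at exponent \<open>N\<close> the power vanishes.\<close>

lemma Y_G: "a \<le> j \<Longrightarrow> j < a + k \<Longrightarrow> a + k \<le> Suc t \<Longrightarrow> u \<in> G k \<Longrightarrow> root_vec t j \<star> u \<in> G k"
proof (induction k arbitrary: u)
  case (Suc k)
  show ?case
  proof (rule G_linear_image_G[where F = "(\<star>) (root_vec t j)", OF _ _ _ Suc.prems(4)])
    fix m u assume mu: "m < N" "u \<in> G k"
    let ?J = "a + k"
    show "root_vec t j \<star> (pw (root_vec t ?J) m \<star> u) \<in> G (Suc k)"
    proof (cases "j < ?J")
      case True
      have "root_vec t j \<star> root_vec t ?J = fscale (sc t j ?J) (root_vec t ?J \<star> root_vec t j)"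
        using Suc.prems True a tn by (intro Y_commute) auto
      from pw_commute_scaled[OF this, of m]
      have "root_vec t j \<star> (pw (root_vec t ?J) m \<star> u) = fscale (sc t j ?J ^ m) (pw (root_vec t ?J) m \<star> (root_vec t j \<star> u))"
        by (simp flip: mul_assoc)
      also have "\<dots> \<in> G (Suc k)"
        using Suc.IH[of u] Suc.prems True mu by (intro G_closed G_gen) auto
      finally show ?thesis .
    next
      case False
      then have j: "j = ?J" using Suc.prems by simp
      have e: "root_vec t j \<star> (pw (root_vec t ?J) m \<star> u) = pw (root_vec t ?J) (Suc m) \<star> u" unfolding j by (simp add: mul_assoc)
      show ?thesis
      proof (cases "Suc m < N")
        case True
        then show ?thesis unfolding e using mu by (intro G_gen)
      next
        case False
        then have "Suc m = N" using mu by simp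
        moreover have "pw (root_vec t ?J) N = 0" using a tn Suc.prems by (intro pw_Y_N) auto
        ultimately show ?thesis unfolding e using G_closed(3)[of "Suc k"] by (simp del: pbw_span.simps pw.simps)
      qed
    qed
  qed simp_all
qed simp

lemma letter_Y_cases:
  assumes "a \<le> i" "i < t" "a \<le> j" "j \<le> t"
  shows "\<exists>s. letter i \<star> root_vec t j = fscale s (root_vec t j \<star> letter i) \<or>
    (j = Suc i \<and> (\<exists>c. letter i \<star> root_vec t j = fscale s (root_vec t j \<star> letter i) + fscale c (root_vec t i)))"
proof -
  consider "j = Suc i" | "j = i" | "j < i" | "Suc i < j" by linarith
  then show ?thesis
  proof cases
    case 1
    have "\<exists>s c. letter i \<star> root_vec t j = fscale s (root_vec t j \<star> letter i) + fscale c (root_vec t i)"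
      unfolding 1 by (intro exI, rule letter_Y_pred) (use 1 assms a tn in simp_all)
    then show ?thesis using 1 by blast
  next
    case 2 then show ?thesis using letter_Y_same[of i t] assms a tn by auto
  next
    case 3 then show ?thesis using letter_Y_inner[of j t i] assms a tn by auto
  next
    case 4 then show ?thesis using letter_Y_far[of i t j] assms a tn by auto
  qed
qed

text \<open>A letter passes every root vector up to a scalar except for \<open>?J = Suc i\<close>.
  The correction term there involves \<open>root_vec t i\<close>, adjoined one stage earlier, and is
  absorbed by \<open>Y_G\<close>.\<close>

lemma letter_G: "a \<le> i \<Longrightarrow> i < t \<Longrightarrow> a + k \<le> Suc t \<Longrightarrow> u \<in> G k \<Longrightarrow> letter i \<star> u \<in> G k"
proof (induction k arbitrary: u)
  case 0
  then have "letter i \<in> alph_span {a..<t}" by (intro letter_alph_span) auto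
  then show ?case using 0 by (simp add: alph_span_mul)
next
  case (Suc k)
  let ?J = "a + k"
  have 1: "letter i \<star> (pw (root_vec t ?J) m \<star> u) \<in> G (Suc k)" if "m < N" "u \<in> G k" for m u
    using that
  proof (induction m)
    case 0
    then show ?case using Suc.IH[of u] Suc.prems G_mono by auto
  next
    case (Suc m)
    have mem: "letter i \<star> (pw (root_vec t ?J) m \<star> u) \<in> G (Suc k)" "pw (root_vec t ?J) m \<star> u \<in> G (Suc k)"
      using Suc by (auto intro!: G_gen simp del: pbw_span.simps)
    have YJ: "root_vec t ?J \<star> (letter i \<star> (pw (root_vec t ?J) m \<star> u)) \<in> G (Suc k)"
      using \<open>a + Suc k \<le> Suc t\<close> by (intro Y_G mem) auto
    have e: "letter i \<star> (pw (root_vec t ?J) (Suc m) \<star> u) = (letter i \<star> root_vec t ?J) \<star> (pw (root_vec t ?J) m \<star> u)"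
      by (simp add: mul_assoc)
    obtain s where "letter i \<star> root_vec t ?J = fscale s (root_vec t ?J \<star> letter i) \<or>
      (?J = Suc i \<and> (\<exists>c. letter i \<star> root_vec t ?J = fscale s (root_vec t ?J \<star> letter i) + fscale c (root_vec t i)))"
      using letter_Y_cases[of i ?J] \<open>a \<le> i\<close> \<open>i < t\<close> \<open>a + Suc k \<le> Suc t\<close> by auto
    then show ?case
    proof
      assume s: "letter i \<star> root_vec t ?J = fscale s (root_vec t ?J \<star> letter i)"
      show ?thesis unfolding e s using G_closed(2)[OF YJ] by (simp add: mul_assoc del: pbw_span.simps)
    next
      assume "?J = Suc i \<and> (\<exists>c. letter i \<star> root_vec t ?J = fscale s (root_vec t ?J \<star> letter i) + fscale c (root_vec t i))"
      then obtain c where J: "?J = Suc i" and s: "letter i \<star> root_vec t ?J = fscale s (root_vec t ?J \<star> letter i) + fscale c (root_vec t i)"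
        by blast
      have "root_vec t i \<star> (pw (root_vec t ?J) m \<star> u) \<in> G (Suc k)"
        using J \<open>a \<le> i\<close> \<open>a + Suc k \<le> Suc t\<close> by (intro Y_G mem) auto
      then show ?thesis
        unfolding e s using G_closed(1)[OF G_closed(2)[OF YJ, of s] G_closed(2), of "root_vec t i \<star> (pw (root_vec t ?J) m \<star> u)" c]
        by (simp add: mul_assoc del: pbw_span.simps)
    qed
  qed
  show ?case
    by (rule G_linear_image_G[where F = "(\<star>) (letter i)", OF _ _ _ Suc.prems(4)]) (use 1 in \<open>simp_all del: pbw_span.simps\<close>)
qed

text \<open>\<open>letter_Y_pred\<close> is solved for the longer root vector. This is how a bare
  coalgebra word is seen to lie in the subalgebra generated by the letters.\<close>

lemma Y_alph_span: "a \<le> j \<Longrightarrow> j \<le> t \<Longrightarrow> root_vec t j \<in> alph_span {a..t}"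
proof -
  assume aj: "a \<le> j" and "j \<le> t"
  from this(2,1) show ?thesis
  proof (induction j rule: inc_induct)
    case base
    show ?case unfolding Y_top using a_le_t by (intro letter_alph_span) auto
  next
    case (step j)
    let ?b = "root_bich t j (Suc j) * (1 - q)"
    have nz: "?b \<noteq> 0"
      using bich_nz[of "[j]" "root_word t (Suc j)"] step a tn by (auto simp: set_root_word)
    have L: "letter j \<in> alph_span {a..t}" "root_vec t (Suc j) \<in> alph_span {a..t}" using step by (auto intro!: letter_alph_span)
    have "fscale ?b (root_vec t j) = letter j \<star> root_vec t (Suc j) - fscale (q * root_bich t j (Suc j)) (root_vec t (Suc j) \<star> letter j)"
      using letter_Y_pred[of j t] step a tn by simp
    also have "\<dots> \<in> alph_span {a..t}" using L by (intro alph_span_closed alph_span_mul)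
    finally have "fscale (inverse ?b) (fscale ?b (root_vec t j)) \<in> alph_span {a..t}" by (rule alph_span_closed)
    then show ?case unfolding fs.scale_scale left_inverse[OF nz] fs.scale_one .
  qed
qed

lemma pw_alph_span: "f \<in> alph_span S \<Longrightarrow> pw f m \<in> alph_span S"
  by (induction m) (auto simp: alph_span_one alph_span_mul)

lemma G_alph_span: "a + k \<le> Suc t \<Longrightarrow> G k \<subseteq> alph_span {a..t}"
proof (induction k)
  case 0
  have "fs.span (xw ` {w. set w \<subseteq> {a..<t}}) \<subseteq> fs.span (xw ` {w. set w \<subseteq> {a..t}})"
    by (intro fs.span_mono image_mono) auto
  then show ?case by (simp add: alph_span_def)
next
  case (Suc k)
  then have "pw (root_vec t (a + k)) m \<star> u \<in> alph_span {a..t}" if "u \<in> G k" for m u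
    using that by (intro alph_span_mul pw_alph_span Y_alph_span) auto
  then show ?case
    unfolding pbw_span.simps alph_span_def[of "{a..t}"] by (intro fs.span_minimal fs.subspace_span) auto
qed

text \<open>The last stage contains 1 and is stable under left multiplication by every letter, since
  the one letter excluded from \<open>letter_G\<close>, namely \<open>t\<close>, is itself a root
  vector.\<close>

lemma G_top: "G (Suc t - a) = alph_span {a..t}"
proof
  let ?k = "Suc t - a"
  have k: "a + ?k = Suc t" using a_le_t by simp
  show "G ?k \<subseteq> alph_span {a..t}" by (rule G_alph_span) (simp add: k)
  have one: "delta [] \<in> G k" for k
  proof (induction k)
    case (Suc k) then show ?case using G_mono by blast
  qed (simp add: alph_span_one)
  have "xw w \<in> G ?k" if "set w \<subseteq> {a..t}" for w
    using that
  proof (induction w)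
    case (Cons i w)
    show ?case
    proof (cases "i = t")
      case True
      then show ?thesis using Y_G[of t ?k "xw w"] Cons k a_le_t by (simp add: Y_top)
    next
      case False
      then show ?thesis using letter_G[of i ?k "xw w"] Cons k by simp
    qed
  qed (simp add: one)
  then show "alph_span {a..t} \<subseteq> G ?k"
    unfolding alph_span_def
    by (intro fs.span_minimal fs.subspaceI G_closed) auto
qed

lemma tw_G: "u \<in> G k \<Longrightarrow> tw v u \<in> G k"
proof (induction k arbitrary: u)
  case 0 then show ?case by (simp add: tw_alph_span)
next
  case (Suc k)
  show ?case
  proof (rule G_linear_image_G[where F = "tw v", OF _ _ _ Suc.prems])
    fix m u assume "m < N" "u \<in> G k"
    then show "tw v (pw (root_vec t (a + k)) m \<star> u) \<in> G (Suc k)"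
      using G_closed(2)[OF G_gen[OF _ Suc.IH]] by (simp add: tw_mul tw_pw[OF tw_root_vec] del: pbw_span.simps)
  qed simp_all
qed

lemma rd_pw_Y_other: "i \<noteq> j \<Longrightarrow> rd i (pw (root_vec t j) m) = 0"
  by (induction m) (auto simp: rd_mul rd_root_vec)

lemma rd_G: "u \<in> G k \<Longrightarrow> a + k \<le> i \<Longrightarrow> rd i u \<in> G k"
proof (induction k arbitrary: u)
  case 0 then show ?case by (simp add: rd_alph_span)
next
  case (Suc k)
  show ?case
  proof (rule G_linear_image_G[where F = "rd i", OF _ _ _ Suc.prems(1)])
    fix m u assume "m < N" "u \<in> G k"
    then show "rd i (pw (root_vec t (a + k)) m \<star> u) \<in> G (Suc k)"
      using G_gen[OF _ Suc.IH] Suc.prems by (simp add: rd_mul rd_pw_Y_other del: pbw_span.simps)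
  qed simp_all
qed

text \<open>Among the root vectors only \<open>root_vec t t\<close> has a word ending in
  \<open>t\<close>, and it is adjoined at the very last stage.\<close>

lemma rd_G_zero: "u \<in> G k \<Longrightarrow> a + k \<le> t \<Longrightarrow> rd t u = 0"
proof (induction k arbitrary: u)
  case 0 then show ?case using rd_alph_span_zero[of u "{a..<t}" t] by simp
next
  case (Suc k)
  have "rd t u \<in> fs.span {}"
  proof (rule G_linear_image[where F = "rd t", OF _ _ _ Suc.prems(1)])
    fix m u assume "m < N" "u \<in> G k"
    then show "rd t (pw (root_vec t (a + k)) m \<star> u) \<in> fs.span {}"
      using Suc.IH[of u] Suc.prems by (simp add: rd_mul rd_pw_Y_other)
  qed simp_all
  then show ?case by simp
qed

text \<open>The derivations of the chain preserve stage \<open>k\<close> until the last one, by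
  \<open>t\<close>, annihilates it.\<close>

lemma chain_G_zero:
  assumes "u \<in> G k" "a + k \<le> J" "J \<le> t"
  shows "chain t J u = 0"
  using assms(3,1,2)
proof (induction J arbitrary: u rule: inc_induct)
  case base then show ?case by (simp add: chain_rec rd_G_zero)
next
  case (step J)
  then show ?case using rd_G[of u k J] by (simp add: chain_rec)
qed

text \<open>In the Leibniz expansion, a term in which the derivation by \<open>J\<close> hits
  \<open>u\<close> dies: the later ones pass the untouched root vector and annihilate the rest. Only
  the term in which all of them act on the root vector survives.\<close>

lemma chain_Y:
  assumes "u \<in> G k" "a + k \<le> J" "J \<le> t"
  shows "chain t J (root_vec t J \<star> u) = tw [J..<Suc t] u"
  using assms(3,1,2)
proof (induction J arbitrary: u rule: inc_induct)
  case base
  then show ?case by (simp add: chain_rec rd_mul rd_G_zero rd_root_vec Y_top)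
next
  case (step J)
  have "chain t J (root_vec t J \<star> u) = chain t (Suc J) (root_vec t J \<star> rd J u) + chain t (Suc J) (root_vec t (Suc J) \<star> tw [J] u)"
    using step.hyps by (simp add: chain_rec rd_mul rd_root_vec)
  also have "chain t (Suc J) (root_vec t J \<star> rd J u) = root_vec t J \<star> chain t (Suc J) (rd J u)"
    using step.hyps by (intro chain_mul) (auto simp: rd_root_vec)
  also have "chain t (Suc J) (rd J u) = 0"
    using step.hyps step.prems by (intro chain_G_zero[of _ k] rd_G) auto
  also have "chain t (Suc J) (root_vec t (Suc J) \<star> tw [J] u) = tw [Suc J..<Suc t] (tw [J] u)"
    using step.prems by (intro step.IH tw_G) auto
  also have "\<dots> = tw [J..<Suc t] u"
    using step.hyps tw_swap[of "[J]" "[Suc J..<Suc t]" u] by (simp add: upt_conv_Cons del: upt_Suc)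
  finally show ?case by simp
qed

text \<open>The scalar by which the chain lowers an exponent from \<open>Suc m\<close> to
  \<open>m\<close>: the derivative by \<open>J\<close> gives the part with the quantum integer, and
  the remaining derivations twist the \<open>m\<close> untouched root vectors.\<close>

definition kap :: "nat \<Rightarrow> nat \<Rightarrow> 'a" where
  "kap J m = root_bich t J J ^ m * (\<Sum>i<Suc m. inverse q ^ i) * bich [Suc J..<Suc t] (root_word t J) ^ m"

lemma kap_nz:
  assumes "Suc m < N" "a \<le> J" "J \<le> t"
  shows "kap J m \<noteq> 0"
proof -
  have "root_bich t J J \<noteq> 0" using assms a tn by (intro bich_nz) (auto simp: set_root_word)
  moreover have "bich [Suc J..<Suc t] (root_word t J) \<noteq> 0" using assms a tn by (intro bich_nz) (auto simp: set_root_word)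
  moreover have "(\<Sum>i<Suc m. inverse q ^ i) \<noteq> 0" using assms by (intro sum_inverse_q) auto
  ultimately show ?thesis unfolding kap_def by (simp del: upt_Suc sum.lessThan_Suc)
qed

lemma chain_pw_Suc:
  assumes "u \<in> G k" "a + k = J" "J \<le> t" "Suc m < N"
  shows "chain t J (pw (root_vec t J) (Suc m) \<star> u) = fscale (kap J m) (pw (root_vec t J) m \<star> tw [J..<Suc t] u)"
proof -
  let ?v = "[Suc J..<Suc t]" and ?k = "root_bich t J J ^ m * (\<Sum>i<Suc m. inverse q ^ i)"
  have rd: "rd J (pw (root_vec t J) (Suc m) \<star> u) = pw (root_vec t J) (Suc m) \<star> rd J u + fscale ?k (root_vec t (Suc J) \<star> (pw (root_vec t J) m \<star> tw [J] u))"
    using assms a tn by (simp add: rd_mul rd_pw_Y mul_assoc del: pw.simps sum.lessThan_Suc)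
  \<comment> \<open>Here the derivation by \<open>J\<close> has hit \<open>u\<close>. The full power
    of \<open>root_vec t J\<close> remains, so the term lies in stage \<open>Suc k\<close>, which
    the rest of the chain annihilates; for \<open>J = t\<close> the derivative of \<open>u\<close>
    is already zero.\<close>
  have 1: "chain t (Suc J) (pw (root_vec t J) (Suc m) \<star> rd J u) = 0"
  proof (cases "J = t")
    case True then show ?thesis using assms by (simp add: rd_G_zero)
  next
    case False
    have "pw (root_vec t J) (Suc m) \<star> rd J u \<in> G (Suc k)"
      unfolding assms(2)[symmetric] using assms by (intro G_gen rd_G) auto
    then show ?thesis using False assms by (intro chain_G_zero[of _ "Suc k"]) auto
  qed
  have g: "pw (root_vec t J) m \<star> tw [J] u \<in> G (Suc k)"
    unfolding assms(2)[symmetric] using assms by (intro G_gen tw_G) auto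
  have 2: "chain t (Suc J) (root_vec t (Suc J) \<star> (pw (root_vec t J) m \<star> tw [J] u)) = tw ?v (pw (root_vec t J) m \<star> tw [J] u)"
  proof (cases "J = t")
    case True then show ?thesis by (simp add: Y_top)
  next
    case False
    then show ?thesis using assms g by (intro chain_Y[of _ "Suc k"]) auto
  qed
  have 3: "tw ?v (tw [J] u) = tw [J..<Suc t] u"
    using assms tw_swap[of "[J]" ?v u] by (simp add: upt_conv_Cons del: upt_Suc)
  have "chain t J (pw (root_vec t J) (Suc m) \<star> u) = fscale ?k (tw ?v (pw (root_vec t J) m \<star> tw [J] u))"
    using assms by (simp add: chain_rec rd 1 2 del: pw.simps upt_Suc sum.lessThan_Suc)
  also have "tw ?v (pw (root_vec t J) m \<star> tw [J] u) = fscale (bich ?v (root_word t J) ^ m) (pw (root_vec t J) m \<star> tw [J..<Suc t] u)"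
    unfolding tw_mul tw_pw[OF tw_root_vec] 3 by simp
  finally show ?thesis by (simp add: kap_def del: upt_Suc sum.lessThan_Suc)
qed

lemma tw_inj:
  assumes "u \<in> alph_span {a..t}" "set v \<subseteq> {1..n}" "tw v u = 0"
  shows "u = 0"
proof
  fix w
  show "u w = 0 w"
  proof (rule ccontr)
    assume "u w \<noteq> 0 w"
    then have nz: "u w \<noteq> 0" by (simp add: fun_apply)
    have "set w \<subseteq> {a..t}" using alph_span_support[OF assms(1) nz] .
    then have "bich v w \<noteq> 0" using assms(2) a tn by (intro bich_nz) auto
    moreover have "bich v w * u w = 0" using fun_cong[OF assms(3), of w] by (simp add: tw_def fun_apply)
    ultimately show False using nz by simp
  qed
qed

text \<open>Induction on \<open>M\<close>: \<open>chain t J\<close> lowers the power of \<open>root_vec t J\<close> by one and kills the constant term.\<close>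

lemma pw_independent:
  assumes "\<And>m. m < M \<Longrightarrow> u m \<in> G k" "a + k = J" "J \<le> t" "M \<le> N"
    and "(\<Sum>m<M. pw (root_vec t J) m \<star> u m) = 0" "m < M"
  shows "u m = 0"
  using assms(1,4-6)
proof (induction M arbitrary: u m)
  case (Suc M)
  let ?v = "[J..<Suc t]"
  have c0: "chain t J (u 0) = 0" using Suc.prems assms(2,3) by (intro chain_G_zero[of _ k]) auto
  have "0 = chain t J (\<Sum>m<Suc M. pw (root_vec t J) m \<star> u m)" using Suc.prems(3) by simp
  also have "\<dots> = chain t J (u 0) + (\<Sum>m<M. chain t J (pw (root_vec t J) (Suc m) \<star> u (Suc m)))"
    unfolding sum.lessThan_Suc_shift by (simp add: chain_sum del: pw.simps(2))
  also have "\<dots> = (\<Sum>m<M. pw (root_vec t J) m \<star> fscale (kap J m) (tw ?v (u (Suc m))))"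
    using Suc.prems(1,2) assms(2,3) c0 by (simp add: chain_pw_Suc[of _ k] del: pw.simps upt_Suc)
  finally have s: "(\<Sum>m<M. pw (root_vec t J) m \<star> fscale (kap J m) (tw ?v (u (Suc m)))) = 0" ..
  have z: "u (Suc m) = 0" if m: "m < M" for m
  proof -
    have "fscale (kap J m) (tw ?v (u (Suc m))) = 0"
      by (rule Suc.IH[of "\<lambda>m. fscale (kap J m) (tw ?v (u (Suc m)))", OF _ _ s m])
        (use Suc.prems(1,2) in \<open>auto intro!: G_closed tw_G simp del: upt_Suc\<close>)
    then have "tw ?v (u (Suc m)) = 0"
      using kap_nz[of m J] m Suc.prems(2) assms(2,3) by simp
    moreover have "u (Suc m) \<in> alph_span {a..t}"
      by (rule subsetD[OF G_alph_span Suc.prems(1)]) (use assms(2,3) m in simp_all)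
    ultimately show ?thesis
      by - (rule tw_inj[of _ ?v], use assms(2,3) a tn in \<open>auto simp del: upt_Suc\<close>)
  qed
  have rest: "(\<Sum>m<M. pw (root_vec t J) (Suc m) \<star> u (Suc m)) = 0"
    by (rule sum.neutral) (simp add: z del: pw.simps)
  have "pw (root_vec t J) 0 \<star> u 0 + (\<Sum>m<M. pw (root_vec t J) (Suc m) \<star> u (Suc m)) = 0"
    by (rule trans[OF sum.lessThan_Suc_shift[of "\<lambda>m. pw (root_vec t J) m \<star> u m" M, symmetric] Suc.prems(3)])
  then have "u 0 = 0" unfolding rest by (simp only: pw.simps(1) mul_one add_0_right)
  show ?case
  proof (cases "m = 0")
    case True
    show ?thesis unfolding True by fact
  next
    case False
    then have "m - 1 < M" "Suc (m - 1) = m" using \<open>m < Suc M\<close> by simp_all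
    then show ?thesis using z[of "m - 1"] by metis
  qed
next
  case 0
  from \<open>m < 0\<close> show ?case by (rule less_zeroE)
qed

text \<open>By \<open>pw_independent\<close> the \<open>N\<close> powers of the new root vector
  behave like a basis over the previous stage.\<close>

lemma has_dim_G_Suc:
  assumes "has_dim (G k) d" "a + k \<le> t"
  shows "has_dim (G (Suc k)) (N * d)"
proof -
  let ?J = "a + k"
  obtain C where C: "finite C" "indep_fam C (\<lambda>b. b)" "fs.span C = G k" "card C = d"
    using assms(1) by (rule has_dimE)
  let ?g = "\<lambda>(m, b). pw (root_vec t ?J) m \<star> b" and ?I = "{..<N} \<times> C"
  have "indep_fam ?I ?g"
    unfolding indep_fam_def
  proof (intro allI impI)
    fix c :: "nat \<times> (nat list \<Rightarrow> 'a) \<Rightarrow> 'a" assume "(\<Sum>i\<in>?I. fscale (c i) (?g i)) = 0"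
    also have "(\<Sum>i\<in>?I. fscale (c i) (?g i)) = (\<Sum>m<N. pw (root_vec t ?J) m \<star> (\<Sum>b\<in>C. fscale (c (m, b)) b))"
      by (simp add: sum.cartesian_product mul_sum case_prod_unfold)
    finally have s: "(\<Sum>m<N. pw (root_vec t ?J) m \<star> (\<Sum>b\<in>C. fscale (c (m, b)) b)) = 0" .
    have "(\<Sum>b\<in>C. fscale (c (m, b)) b) = 0" if "m < N" for m
    proof (rule pw_independent[OF _ refl assms(2) order.refl s that])
      show "(\<Sum>b\<in>C. fscale (c (m, b)) b) \<in> G k" for m
        unfolding C(3)[symmetric] by (intro fs.span_sum fs.span_scale fs.span_base)
    qed
    then show "\<forall>i\<in>?I. c i = 0"
      using indep_famD[OF C(2), of "\<lambda>b. c (m, b)" for m] by auto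
  qed
  moreover have "fs.span (?g ` ?I) = G (Suc k)"
  proof (rule antisym)
    have "C \<subseteq> G k" unfolding C(3)[symmetric] by (rule fs.span_superset)
    then have "?g ` ?I \<subseteq> {pw (root_vec t ?J) m \<star> u | m u. m < N \<and> u \<in> G k}" by auto
    then show "fs.span (?g ` ?I) \<subseteq> G (Suc k)" unfolding pbw_span.simps by (rule fs.span_mono)
    have "pw (root_vec t ?J) m \<star> u \<in> fs.span (?g ` ?I)" if "m < N" "u \<in> G k" for m u
      by (rule span_linear_image[of "(\<star>) (pw (root_vec t ?J) m)", OF _ _ _ that(2)[folded C(3)]])
        (use that(1) in \<open>auto intro!: fs.span_base\<close>)
    then show "G (Suc k) \<subseteq> fs.span (?g ` ?I)"
      unfolding pbw_span.simps by (intro fs.span_minimal fs.subspace_span) auto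
  qed
  ultimately have "has_dim (G (Suc k)) (card ?I)" using C(1) by (intro has_dimI) auto
  then show ?thesis using C(4) by (simp add: card_cartesian_product)
qed

lemma has_dim_alph_span_top:
  assumes "has_dim (alph_span {a..<t}) d"
  shows "has_dim (alph_span {a..t}) (N ^ (Suc t - a) * d)"
proof -
  have "has_dim (G k) (N ^ k * d)" if "a + k \<le> Suc t" for k
    using that
  proof (induction k)
    case (Suc k)
    then show ?case using has_dim_G_Suc[of k "N ^ k * d"] by (simp add: mult.assoc del: pbw_span.simps)
  qed (simp add: assms)
  from this[of "Suc t - a"] show ?thesis using a_le_t unfolding G_top by simp
qed

end

context cartan_A
begin

lemma has_dim_alph_span_interval:
  assumes "1 \<le> a" "a \<le> t" "t \<le> Suc n"
  shows "has_dim (alph_span {a..<t}) (N ^ (Suc (t - a) choose 2))"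
  using assms(2,3)
proof (induction t rule: dec_induct)
  case base
  have "alph_span {} = fs.span {delta []}" by (simp add: alph_span_def)
  moreover have "delta [] [] \<noteq> (0 :: nat list \<Rightarrow> 'a) []" by (simp add: delta_def fun_apply)
  then have "delta [] \<noteq> (0 :: nat list \<Rightarrow> 'a)" by metis
  then have "fs.independent {delta [] :: nat list \<Rightarrow> 'a}" by simp
  ultimately have "has_dim (alph_span {}) 1" unfolding has_dim_def by (intro exI[of _ "{delta []}"]) auto
  then show ?case by (simp add: numeral_2_eq_2)
next
  case (step t)
  interpret cartan_A_interval qm q n N a t
    using step assms by unfold_locales auto
  have "has_dim (alph_span {a..t}) (N ^ (Suc t - a) * N ^ (Suc (t - a) choose 2))"
    using step by (intro has_dim_alph_span_top) auto
  \<comment> \<open>Pascal's rule: the new root vectors turn one triangular number into the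
    next.\<close>
  moreover have "(Suc t - a) + (Suc (t - a) choose 2) = Suc (Suc t - a) choose 2"
    using step by (simp add: numeral_2_eq_2 Suc_diff_le)
  ultimately show ?case by (simp add: power_add[symmetric] atLeastLessThanSuc_atLeastAtMost)
qed

end

section \<open>Counting by supports\<close>

lemma sum_fun_apply: "(\<Sum>i\<in>I. f i) w = (\<Sum>i\<in>I. f i w)"
  by (induction I rule: infinite_finite_induct) (auto simp: fun_apply)

context quantum_shuffle
begin

text \<open>Supports are prescribed exactly, whereas \<open>alph_span\<close> also admits smaller
  ones. Since the coefficients of \<open>xw w\<close> live on words with the same letters as
  \<open>w\<close>, different supports contribute independently.\<close>

definition supp_span :: "nat set set \<Rightarrow> (nat list \<Rightarrow> 'a) set" where
  "supp_span \<S> = fs.span (xw ` {w. set w \<in> \<S>})"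

lemma alph_span_eq_supp_span: "alph_span S = supp_span (Pow S)"
  by (simp add: alph_span_def supp_span_def)

lemma mul_support:
  "(f \<star> g) w \<noteq> 0 \<Longrightarrow> \<exists>u v. f u \<noteq> 0 \<and> g v \<noteq> 0 \<and> set w = set u \<union> set v"
proof (induction w arbitrary: f g rule: rev_induct)
  case Nil
  then show ?case by (intro exI[of _ "[]"]) auto
next
  case (snoc i w)
  from snoc.prems have "(f \<star> rd i g) w \<noteq> 0 \<or> (rd i f \<star> tw [i] g) w \<noteq> 0"
    by (auto simp: mul_snoc)
  then consider "(f \<star> rd i g) w \<noteq> 0" | "(rd i f \<star> tw [i] g) w \<noteq> 0" by blast
  then show ?case
  proof cases
    case 1
    from snoc.IH[OF this] obtain u v where "f u \<noteq> 0" "rd i g v \<noteq> 0" "set w = set u \<union> set v" by blast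
    then show ?thesis by (intro exI[of _ u] exI[of _ "v @ [i]"]) (auto simp: rd_def)
  next
    case 2
    from snoc.IH[OF this] obtain u v where "rd i f u \<noteq> 0" "tw [i] g v \<noteq> 0" "set w = set u \<union> set v" by blast
    then show ?thesis by (intro exI[of _ "u @ [i]"] exI[of _ v]) (auto simp: rd_def tw_def)
  qed
qed

lemma xw_support: "xw w z \<noteq> 0 \<Longrightarrow> set z = set w"
proof (induction w arbitrary: z)
  case Nil then show ?case by (auto simp: delta_def split: if_splits)
next
  case (Cons i w)
  then obtain u v where "letter i u \<noteq> (0::'a)" "xw w v \<noteq> 0" "set z = set u \<union> set v"
    using mul_support[of "letter i" "xw w" z] by auto
  then show ?case using Cons.IH[of v] by (auto simp: letter_def split: if_splits)
qed

lemma supp_span_support: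
  assumes "f \<in> supp_span \<S>" "f w \<noteq> 0" shows "set w \<in> \<S>"
proof -
  let ?V = "{f. \<forall>w. set w \<notin> \<S> \<longrightarrow> f w = 0} :: (nat list \<Rightarrow> 'a) set"
  have "fs.subspace ?V" by (rule fs.subspaceI) (auto simp: fun_apply)
  then have "supp_span \<S> \<subseteq> ?V" unfolding supp_span_def
    using xw_support by (intro fs.span_minimal) force+
  then show ?thesis using assms by blast
qed

lemma supp_span_Un: "supp_span (\<A> \<union> \<B>) = fs.span (supp_span \<A> \<union> supp_span \<B>)"
proof (rule antisym)
  have "xw ` {w. set w \<in> \<A> \<union> \<B>} \<subseteq> supp_span \<A> \<union> supp_span \<B>"
    unfolding supp_span_def using fs.span_superset[of "xw ` {w. set w \<in> \<A>}"] fs.span_superset[of "xw ` {w. set w \<in> \<B>}"]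
    by auto
  then show "supp_span (\<A> \<union> \<B>) \<subseteq> fs.span (supp_span \<A> \<union> supp_span \<B>)"
    unfolding supp_span_def[of "\<A> \<union> \<B>"] by (rule fs.span_mono)
  have "supp_span \<A> \<subseteq> supp_span (\<A> \<union> \<B>)" "supp_span \<B> \<subseteq> supp_span (\<A> \<union> \<B>)"
    unfolding supp_span_def by (intro fs.span_mono image_mono; auto)+
  then show "fs.span (supp_span \<A> \<union> supp_span \<B>) \<subseteq> supp_span (\<A> \<union> \<B>)"
    by (intro fs.span_minimal) (auto simp: supp_span_def fs.subspace_span)
qed

lemma zero_supp_span: "0 \<in> supp_span \<A>"
  by (simp add: supp_span_def fs.span_zero)

lemma supp_span_Int:
  assumes "\<A> \<inter> \<B> = {}" shows "supp_span \<A> \<inter> supp_span \<B> = {0}"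
proof -
  have "f = 0" if f: "f \<in> supp_span \<A>" "f \<in> supp_span \<B>" for f
  proof
    fix w show "f w = 0 w"
      using supp_span_support[OF f(1), of w] supp_span_support[OF f(2), of w] assms by (auto simp: fun_apply)
  qed
  then show ?thesis using zero_supp_span by blast
qed

lemma has_dim_supp_span:
  assumes "finite \<S>" "\<And>S. S \<in> \<S> \<Longrightarrow> has_dim (supp_span {S}) (e S)"
  shows "has_dim (supp_span \<S>) (\<Sum>S\<in>\<S>. e S)"
  using assms
proof (induction \<S>)
  case empty
  show ?case unfolding has_dim_def by (intro exI[of _ "{}"]) (simp add: supp_span_def fs.independent_empty)
next
  case (insert S \<S>)
  have "has_dim (fs.span (supp_span {S} \<union> supp_span \<S>)) (e S + (\<Sum>S\<in>\<S>. e S))"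
    using insert by (intro has_dim_direct_sum supp_span_Int) auto
  then show ?case using insert.hyps supp_span_Un[of "{S}" \<S>] by simp
qed

text \<open>Over disjoint alphabets the word \<open>z @ z'\<close> arises from a single shuffle, one
  without crossings, so its coefficient separates the two factors.\<close>

lemma mul_eval:
  assumes "\<And>w. u w \<noteq> 0 \<Longrightarrow> set w \<subseteq> S" "\<And>w. v w \<noteq> 0 \<Longrightarrow> set w \<subseteq> T" "S \<inter> T = {}"
    and "set z \<subseteq> S" "set z' \<subseteq> T"
  shows "(u \<star> v) (z @ z') = u z * v z'"
proof -
  have rd0: "rd i f = 0" if "\<And>w. f w \<noteq> 0 \<Longrightarrow> set w \<subseteq> U" "i \<notin> U" for i f U
  proof
    fix w show "rd i f w = 0 w" using that(1)[of "w @ [i]"] that(2) by (auto simp: rd_def fun_apply)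
  qed
  have 1: "(u \<star> v) z = u z * v []"
    if "\<And>w. u w \<noteq> 0 \<Longrightarrow> set w \<subseteq> S" "\<And>w. v w \<noteq> 0 \<Longrightarrow> set w \<subseteq> T" for u v
    using assms(4) that
  proof (induction z arbitrary: u v rule: rev_induct)
    case (snoc i z)
    have "rd i v = 0" using snoc.prems(1) assms(3) by (intro rd0[OF snoc.prems(3)]) auto
    moreover have "(rd i u \<star> tw [i] v) z = rd i u z * tw [i] v []"
    proof (rule snoc.IH)
      show "set w \<subseteq> S" if "rd i u w \<noteq> 0" for w
        using snoc.prems(2)[of "w @ [i]"] that by (simp add: rd_def)
      show "set w \<subseteq> T" if "tw [i] v w \<noteq> 0" for w
        using snoc.prems(3)[of w] that by (auto simp: tw_def)
    qed (use snoc.prems in simp)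
    ultimately show ?case by (simp add: mul_snoc fun_apply) (simp add: rd_def)
  qed simp
  show ?thesis using assms(5) assms(2)
  proof (induction z' arbitrary: v rule: rev_induct)
    case Nil then show ?case using 1[OF assms(1)] by simp
  next
    case (snoc i z')
    have "rd i u = 0" using snoc.prems(1) assms(3) by (intro rd0[OF assms(1)]) auto
    moreover have "(u \<star> rd i v) (z @ z') = u z * rd i v z'"
    proof (rule snoc.IH)
      show "set w \<subseteq> T" if "rd i v w \<noteq> 0" for w
        using snoc.prems(2)[of "w @ [i]"] that by (simp add: rd_def)
    qed (use snoc.prems in simp)
    ultimately have "(u \<star> v) ((z @ z') @ [i]) = u z * rd i v z'"
      unfolding mul_snoc by (simp add: fun_apply)
    then show ?case by (simp add: rd_def)
  qed
qed

end

section \<open>Dimensions of support components\<close>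

context cartan_A
begin

definition supp_dim :: "nat set \<Rightarrow> nat" where
  "supp_dim S = fs.dim (supp_span {S})"

lemma has_dim_supp:
  assumes "S \<subseteq> {1..n}" shows "has_dim (supp_span {S}) (supp_dim S)"
  unfolding supp_dim_def
proof (rule has_dim_subspace)
  show "has_dim (alph_span {1..<Suc n}) (N ^ (Suc (Suc n - 1) choose 2))"
    by (rule has_dim_alph_span_interval) auto
  show "fs.subspace (supp_span {S})" unfolding supp_span_def by (rule fs.subspace_span)
  show "supp_span {S} \<subseteq> alph_span {1..<Suc n}"
    unfolding supp_span_def alph_span_def using assms by (intro fs.span_mono image_mono) auto
qed

lemma sum_supp_dim:
  assumes "1 \<le> a" "a \<le> t" "t \<le> Suc n"
  shows "(\<Sum>S\<in>Pow {a..<t}. supp_dim S) = N ^ (Suc (t - a) choose 2)"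
proof -
  have "has_dim (supp_span (Pow {a..<t})) (\<Sum>S\<in>Pow {a..<t}. supp_dim S)"
    using assms by (intro has_dim_supp_span has_dim_supp) auto
  then show ?thesis
    using has_dim_alph_span_interval[OF assms] unfolding alph_span_eq_supp_span by (auto dest!: has_dim_dim)
qed

text \<open>Multiplication identifies the tensor product of the two components with the component of
  the union: \<open>mul_eval\<close> gives injectivity, and sorting words around the gap gives
  surjectivity.\<close>

lemma supp_dim_Un:
  assumes S: "S \<subseteq> {1..n}" and T: "T \<subseteq> {1..n}" and ST: "\<And>x y. x \<in> S \<Longrightarrow> y \<in> T \<Longrightarrow> x + 2 \<le> y"
  shows "supp_dim (S \<union> T) = supp_dim S * supp_dim T"
proof -
  obtain C where C: "finite C" "indep_fam C (\<lambda>b. b)" "fs.span C = supp_span {S}" "card C = supp_dim S"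
    using has_dim_supp[OF S] by (rule has_dimE)
  obtain D where D: "finite D" "indep_fam D (\<lambda>b. b)" "fs.span D = supp_span {T}" "card D = supp_dim T"
    using has_dim_supp[OF T] by (rule has_dimE)
  have disj: "S \<inter> T = {}" using ST by fastforce
  have CS: "u \<in> supp_span {S}" if "u \<in> C" for u using fs.span_superset[of C] that C(3) by auto
  have DT: "v \<in> supp_span {T}" if "v \<in> D" for v using fs.span_superset[of D] that D(3) by auto
  have suppC: "u w \<noteq> 0 \<Longrightarrow> set w = S" if "u \<in> C" for u w using supp_span_support[OF CS[OF that]] by simp
  have suppD: "v w \<noteq> 0 \<Longrightarrow> set w = T" if "v \<in> D" for v w using supp_span_support[OF DT[OF that]] by simp
  let ?g = "\<lambda>(u, v). u \<star> v"
  have "indep_fam (C \<times> D) ?g"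
    unfolding indep_fam_def
  proof (intro allI impI)
    fix c :: "(nat list \<Rightarrow> 'a) \<times> (nat list \<Rightarrow> 'a) \<Rightarrow> 'a"
    assume s: "(\<Sum>i\<in>C \<times> D. fscale (c i) (?g i)) = 0"
    \<comment> \<open>Evaluation at \<open>z @ z'\<close> decouples the double sum when
      \<open>z\<close> and \<open>z'\<close> have the right supports; otherwise every term contains
      a vanishing coefficient. With \<open>z'\<close> fixed, independence of \<open>C\<close>
      applies, and afterwards that of \<open>D\<close>.\<close>
    have ev: "(\<Sum>u\<in>C. (\<Sum>v\<in>D. c (u, v) * v z') * u z) = 0" for z z'
    proof (cases "set z = S \<and> set z' = T")
      case True
      have e: "(u \<star> v) (z @ z') = u z * v z'" if "u \<in> C" "v \<in> D" for u v
        using suppC[OF that(1)] suppD[OF that(2)] disj True by (intro mul_eval[of u S v T]) auto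
      have "0 = (\<Sum>i\<in>C \<times> D. fscale (c i) (?g i)) (z @ z')" unfolding s by (simp add: fun_apply)
      also have "\<dots> = (\<Sum>i\<in>C \<times> D. fscale (c i) (?g i) (z @ z'))"
        by (rule sum_fun_apply)
      also have "\<dots> = (\<Sum>u\<in>C. \<Sum>v\<in>D. c (u, v) * (u z * v z'))"
        unfolding sum.cartesian_product by (intro sum.cong) (auto simp: fun_apply e)
      finally show ?thesis by (simp add: sum_distrib_left sum_distrib_right ac_simps)
    next
      case False
      show ?thesis
      proof (cases "set z = S")
        case True
        then have vz: "v z' = 0" if "v \<in> D" for v using suppD[OF that, of z'] False by auto
        have "(\<Sum>v\<in>D. c (u, v) * v z') = 0" for u by (rule sum.neutral) (simp add: vz)
        then show ?thesis by simp
      next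
        case False
        then have uz: "u z = 0" if "u \<in> C" for u using suppC[OF that, of z] by auto
        show ?thesis by (rule sum.neutral) (simp add: uz)
      qed
    qed
    have "(\<Sum>v\<in>D. c (u, v) * v z') = 0" if "u \<in> C" for u z'
    proof (rule indep_famD[OF C(2) _ that, where c = "\<lambda>u. \<Sum>v\<in>D. c (u, v) * v z'"])
      show "(\<Sum>u\<in>C. fscale (\<Sum>v\<in>D. c (u, v) * v z') u) = 0"
        using ev by (intro ext) (simp add: sum_fun_apply fun_apply)
    qed
    then have "(\<Sum>v\<in>D. fscale (c (u, v)) v) = 0" if "u \<in> C" for u
      using that by (intro ext) (simp add: sum_fun_apply fun_apply)
    then show "\<forall>i\<in>C \<times> D. c i = 0"
      using indep_famD[OF D(2), of "\<lambda>v. c (u, v)" for u] by auto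
  qed
  moreover have "fs.span (?g ` (C \<times> D)) = supp_span {S \<union> T}"
  proof (rule antisym)
    have "u \<star> v \<in> supp_span {S \<union> T}" if "u \<in> C" "v \<in> D" for u v
      unfolding supp_span_def[of "{S \<union> T}"]
    proof (rule span_bilinear_image[of "(\<star>)", OF _ _ _ _ _ CS[OF that(1), unfolded supp_span_def] DT[OF that(2), unfolded supp_span_def]])
      fix x y assume "x \<in> xw ` {w. set w \<in> {S}}" "y \<in> xw ` {w. set w \<in> {T}}"
      then show "x \<star> y \<in> fs.span (xw ` {w. set w \<in> {S \<union> T}})"
        by (auto intro!: fs.span_base simp flip: xw_append)
    qed simp_all
    then have "?g ` (C \<times> D) \<subseteq> supp_span {S \<union> T}" by auto
    then show "fs.span (?g ` (C \<times> D)) \<subseteq> supp_span {S \<union> T}"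
      by (intro fs.span_minimal) (simp_all add: supp_span_def fs.subspace_span)
    \<comment> \<open>A number strictly between \<open>S\<close> and \<open>T\<close>. For empty
      \<open>S\<close> the value 0 serves, because \<open>T\<close> consists of positive
      numbers.\<close>
    define c where "c = (if S = {} then 0 else Suc (Max S))"
    have fin: "finite S" using S finite_subset by blast
    have cS: "x < c" if "x \<in> S" for x
      using that Max_ge[OF fin, of x] by (auto simp: c_def)
    have cT: "c < y" if "y \<in> T" for y
      using that ST[of "Max S" y] T Max_in[OF fin] by (cases "S = {}") (auto simp: c_def)
    have "xw w \<in> fs.span (?g ` (C \<times> D))" if w: "set w = S \<union> T" for w
    proof -
      let ?u = "filter (\<lambda>x. x < c) w" and ?v = "filter (\<lambda>x. c < x) w"
      have "set w \<subseteq> {1..n}" "c \<notin> set w" using w S T cS cT by blast+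
      from xw_split[OF this] obtain s where s: "xw w = fscale s (xw ?u \<star> xw ?v)"
        by (auto simp: xw_append)
      have "set ?u = S" "set ?v = T" using w cS cT by (auto dest: less_asym)
      then have uv: "xw ?u \<in> fs.span C" "xw ?v \<in> fs.span D"
        unfolding C(3) D(3) supp_span_def by (auto intro!: fs.span_base)
      have "xw ?u \<star> xw ?v \<in> fs.span (?g ` (C \<times> D))"
        by (rule span_bilinear_image[of "(\<star>)", OF _ _ _ _ _ uv]) (auto intro!: fs.span_base)
      then show ?thesis unfolding s by (rule fs.span_scale)
    qed
    then show "supp_span {S \<union> T} \<subseteq> fs.span (?g ` (C \<times> D))"
      unfolding supp_span_def by (intro fs.span_minimal fs.subspace_span) auto
  qed
  ultimately have "has_dim (supp_span {S \<union> T}) (card (C \<times> D))"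
    using C(1) D(1) by (intro has_dimI) auto
  then show ?thesis using C(4) D(4) by (simp add: supp_dim_def card_cartesian_product has_dim_dim)
qed

lemma nichols_lie_dim_eq: "nichols_lie_dim n qm = (\<Sum>S | S \<subseteq> {1..n} \<and> conn S. supp_dim S)"
proof -
  have "nichols_lie n qm = supp_span {S. S \<subseteq> {1..n} \<and> conn S}"
    unfolding nichols_lie_eq supp_span_def by (simp add: conj_commute)
  moreover have "has_dim (supp_span {S. S \<subseteq> {1..n} \<and> conn S}) (\<Sum>S | S \<subseteq> {1..n} \<and> conn S. supp_dim S)"
    by (intro has_dim_supp_span has_dim_supp) auto
  ultimately show ?thesis unfolding nichols_lie_dim_def by (simp add: has_dim_dim)
qed

end

text \<open>A disconnected set is split at its first gap \<open>{.., k + 1, ..}\<close>, where \<open>k + 2\<close> is the first element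
  after the gap.\<close>

lemma disconnected_decomposition:
  fixes m :: nat
  defines "\<C> \<equiv> \<lambda>k. {S. S \<subseteq> {1..k} \<and> conn S}" and "\<R> \<equiv> \<lambda>k. {T. T \<subseteq> {k + 2..m} \<and> k + 2 \<in> T}"
  shows "bij_betw (\<lambda>(k, S, T). S \<union> T) (SIGMA k:{1..m - 2}. \<C> k \<times> \<R> k)
    {X. X \<subseteq> {1..m} \<and> X \<noteq> {} \<and> \<not> conn X}"
  unfolding bij_betw_def
proof
  let ?I = "SIGMA k:{1..m - 2}. \<C> k \<times> \<R> k" and ?f = "\<lambda>(k, S, T). S \<union> T"
  \<comment> \<open>This makes \<open>k\<close> unique: if \<open>k < k'\<close>, then both
    \<open>k + 2\<close> and an element of \<open>S\<close> would lie in the connected set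
    \<open>S'\<close>, which would therefore contain the hole \<open>k + 1\<close>.\<close>
  have le: "k' \<le> k" if "k \<in> {1..m - 2}" "S \<in> \<C> k" "T \<in> \<R> k" "S' \<in> \<C> k'" "T' \<in> \<R> k'" "S \<union> T = S' \<union> T'"
    for k k' S S' T T'
  proof (rule ccontr)
    assume "\<not> k' \<le> k"
    then have kk: "k < k'" by simp
    have S: "S \<subseteq> {1..k}" "T \<subseteq> {k + 2..m}" "S' \<subseteq> {1..k'}" "T' \<subseteq> {k' + 2..m}" "conn S" "conn S'" "k + 2 \<in> T"
      using that by (auto simp: \<C>_def \<R>_def)
    obtain x where x: "x \<in> S" using S(5) by (auto simp: conn_def)
    have k1: "k + 1 \<notin> S \<union> T" using S by auto
    have "k + 2 \<in> S' \<union> T'" "x \<in> S' \<union> T'" using S(7) x that(6) by auto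
    moreover have "x \<le> k" using x S(1) by auto
    moreover have "k' + 1 \<notin> S' \<union> T'" using S by auto
    ultimately have "x \<in> S'" "k + 2 \<in> S'" using kk S(4) by auto
    then have "k + 1 \<in> S'" using connD[OF S(6), of x "k + 2" "k + 1"] \<open>x \<le> k\<close> by simp
    then show False using k1 that(6) by auto
  qed
  show "inj_on ?f ?I"
  proof (rule inj_onI)
    fix p p' assume p: "p \<in> ?I" "p' \<in> ?I" "?f p = ?f p'"
    obtain k S T k' S' T' where pp: "p = (k, S, T)" "p' = (k', S', T')" by (metis prod_cases3)
    have k: "k = k'" using p le[of k S T S' k' T'] le[of k' S' T' S k T] unfolding pp by auto
    have "S = (S \<union> T) \<inter> {..k}" "T = (S \<union> T) \<inter> {k + 2..}" "S' = (S' \<union> T') \<inter> {..k}" "T' = (S' \<union> T') \<inter> {k + 2..}"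
      using p unfolding pp k by (auto simp: \<C>_def \<R>_def)
    moreover have "S \<union> T = S' \<union> T'" using p(3) unfolding pp by simp
    ultimately show "p = p'" unfolding pp k by metis
  qed
  show "?f ` ?I = {X. X \<subseteq> {1..m} \<and> X \<noteq> {} \<and> \<not> conn X}"
  proof (intro equalityI subsetI)
    fix X assume "X \<in> ?f ` ?I"
    then obtain k S T where X: "X = S \<union> T" "k \<in> {1..m - 2}" "S \<in> \<C> k" "T \<in> \<R> k" by auto
    then have S: "S \<subseteq> {1..k}" "T \<subseteq> {k + 2..m}" "conn S" "k + 2 \<in> T" by (auto simp: \<C>_def \<R>_def)
    obtain x where x: "x \<in> S" using S(3) by (auto simp: conn_def)
    have "k + 1 \<notin> X" using S X(1) by auto
    moreover have "x \<in> X" "k + 2 \<in> X" "x \<le> k + 1" using x S X(1) by auto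
    ultimately have "\<not> conn X" using connD[of X x "k + 2" "k + 1"] by auto
    moreover have "X \<subseteq> {1..m}" using S X(1,2) by fastforce
    ultimately show "X \<in> {X. X \<subseteq> {1..m} \<and> X \<noteq> {} \<and> \<not> conn X}" using x X(1) by auto
  next
    fix X assume "X \<in> {X. X \<subseteq> {1..m} \<and> X \<noteq> {} \<and> \<not> conn X}"
    then have X: "X \<subseteq> {1..m}" "X \<noteq> {}" "\<not> conn X" by auto
    \<comment> \<open>Below, \<open>b\<close> is the least element, \<open>g\<close> the first
      missing number above it, and \<open>d\<close> the first element above \<open>g\<close>. Then
      \<open>k = d - 2\<close> makes \<open>k + 1\<close> the last point of the gap; the gap may be
      longer, so \<open>{b..<g}\<close> need not reach \<open>k\<close>.\<close>
    define b where "b = Min X"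
    have fin: "finite X" using X(1) finite_subset by blast
    have b: "b \<in> X" "\<And>x. x \<in> X \<Longrightarrow> b \<le> x" using Min_in[OF fin X(2)] Min_le[OF fin] by (auto simp: b_def)
    obtain x y where "x \<in> X" "y \<in> X" "\<not> {x..y} \<subseteq> X" using X(2,3) unfolding conn_def by blast
    then obtain c where c: "x \<in> X" "y \<in> X" "x \<le> c" "c \<le> y" "c \<notin> X" by (meson atLeastAtMost_iff subsetI)
    have "b \<le> c" "c \<noteq> b" "c \<noteq> y" using c b le_trans by blast+
    then have bc: "b < c \<and> c \<notin> X" and cy: "c < y" using c by auto
    have "\<exists>g. (b < g \<and> g \<notin> X) \<and> (\<forall>h<g. \<not> (b < h \<and> h \<notin> X))"
      using exists_least_iff[of "\<lambda>g. b < g \<and> g \<notin> X"] bc by blast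
    then obtain g where g: "b < g" "g \<notin> X" and g': "\<forall>h<g. \<not> (b < h \<and> h \<notin> X)" by blast
    have gmin: "h \<in> X" if "b < h" "h < g" for h using g' that by blast
    have gc: "g \<le> c" using g' bc by (meson not_le)
    have gy: "g < y \<and> y \<in> X" using gc cy c by auto
    have "\<exists>d. (g < d \<and> d \<in> X) \<and> (\<forall>h<d. \<not> (g < h \<and> h \<in> X))"
      using exists_least_iff[of "\<lambda>d. g < d \<and> d \<in> X"] gy by blast
    then obtain d where d: "g < d" "d \<in> X" and dmin: "\<forall>h<d. \<not> (g < h \<and> h \<in> X)" by blast
    have b1: "1 \<le> b" "d \<le> m" using b(1) d(2) X(1) by auto
    define k where "k = d - 2"
    have dk: "d = k + 2" "1 \<le> k" "k \<le> m - 2" using b1 g d by (auto simp: k_def)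
    let ?S = "{b..<g}" and ?T = "X \<inter> {k + 2..}"
    have "conn ?S" using g by (auto simp: conn_def)
    moreover have "?S \<subseteq> {1..k}" using b1 d dk by auto
    ultimately have "?S \<in> \<C> k" by (simp add: \<C>_def)
    moreover have "?T \<in> \<R> k" using X(1) d dk by (auto simp: \<R>_def)
    moreover have "X = ?S \<union> ?T"
    proof (intro equalityI subsetI)
      fix h assume h: "h \<in> X"
      then have "h \<noteq> g" "\<not> (g < h \<and> h < d)" "b \<le> h" using h g dmin b by auto
      then show "h \<in> ?S \<union> ?T" using h dk by auto
    next
      fix h assume "h \<in> ?S \<union> ?T"
      then show "h \<in> X" using gmin[of h] b(1) by (cases "h = b") auto
    qed
    ultimately show "X \<in> ?f ` ?I"
      using dk by (intro image_eqI[of _ _ "(k, ?S, ?T)"]) auto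
  qed
qed

section \<open>The recursion and the alternating sum\<close>

context cartan_A
begin

definition cdim :: "nat \<Rightarrow> int" where
  "cdim m = (\<Sum>S | S \<subseteq> {1..m} \<and> conn S. int (supp_dim S))"

lemma cdim_rec:
  assumes "m \<le> n"
  shows "cdim m = int N ^ (Suc m choose 2) - 1
    - (\<Sum>k = 1..m - 2. (int N ^ ((m - k) choose 2) - int N ^ ((m - k - 1) choose 2)) * cdim k)"
proof -
  let ?\<C> = "\<lambda>k. {S. S \<subseteq> {1..k} \<and> conn S}" and ?\<R> = "\<lambda>k. {T. T \<subseteq> {k + 2..m} \<and> k + 2 \<in> T}"
  let ?X = "{X. X \<subseteq> {1..m} \<and> X \<noteq> {} \<and> \<not> conn X}"
  let ?e = "\<lambda>S. int (supp_dim S)"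
  have tot: "(\<Sum>S\<in>Pow {a..<t}. ?e S) = int N ^ (Suc (t - a) choose 2)" if "1 \<le> a" "a \<le> t" "t \<le> Suc n" for a t
    using arg_cong[OF sum_supp_dim[OF that], of int] by simp
  have "Pow {1..m} = {{}} \<union> (?\<C> m \<union> ?X)" by (auto simp: conn_def)
  then have "(\<Sum>S\<in>Pow {1..m}. ?e S) = (\<Sum>S\<in>{{}} \<union> (?\<C> m \<union> ?X). ?e S)" by simp
  also have "\<dots> = ?e {} + (\<Sum>S\<in>?\<C> m \<union> ?X. ?e S)"
    by (subst sum.union_disjoint) (auto simp: conn_def)
  also have "(\<Sum>S\<in>?\<C> m \<union> ?X. ?e S) = cdim m + (\<Sum>S\<in>?X. ?e S)"
    unfolding cdim_def by (rule sum.union_disjoint) auto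
  also have "?e {} = 1" using tot[of 1 1] by (simp add: numeral_2_eq_2)
  also have "(\<Sum>S\<in>?X. ?e S) = (\<Sum>(k, S, T)\<in>(SIGMA k:{1..m - 2}. ?\<C> k \<times> ?\<R> k). ?e (S \<union> T))"
    by (subst sum.reindex_bij_betw[OF disconnected_decomposition, symmetric]) (auto intro!: sum.cong)
  also have "\<dots> = (\<Sum>k = 1..m - 2. \<Sum>(S, T)\<in>?\<C> k \<times> ?\<R> k. ?e (S \<union> T))"
  proof (subst sum.Sigma[symmetric])
    show "\<forall>k\<in>{1..m - 2}. finite (?\<C> k \<times> ?\<R> k)" by auto
  qed (simp_all add: case_prod_unfold)
  also have "\<dots> = (\<Sum>k = 1..m - 2. (int N ^ ((m - k) choose 2) - int N ^ ((m - k - 1) choose 2)) * cdim k)"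
  proof (rule sum.cong[OF refl])
    fix k assume k: "k \<in> {1..m - 2}"
    have k2: "k + 2 \<le> m" using k by auto
    have "(\<Sum>(S, T)\<in>?\<C> k \<times> ?\<R> k. ?e (S \<union> T)) = (\<Sum>(S, T)\<in>?\<C> k \<times> ?\<R> k. ?e S * ?e T)"
    proof (rule sum.cong[OF refl], clarify)
      fix S T assume "S \<subseteq> {1..k}" "T \<subseteq> {k + 2..m}"
      then have "supp_dim (S \<union> T) = supp_dim S * supp_dim T"
        using k2 assms by (intro supp_dim_Un) fastforce+
      then show "?e (S \<union> T) = ?e S * ?e T" by simp
    qed
    also have "\<dots> = cdim k * (\<Sum>T\<in>?\<R> k. ?e T)"
      by (simp add: sum.cartesian_product[symmetric] cdim_def sum_product)
    \<comment> \<open>Supports containing \<open>k + 2\<close> are those inside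
      \<open>{k + 2..m}\<close> minus those inside \<open>{k + 3..m}\<close>. These intervals have
      \<open>m - k - 1\<close> and \<open>m - k - 2\<close> letters, whence the two
      binomials.\<close>
    also have "(\<Sum>T\<in>?\<R> k. ?e T) = int N ^ ((m - k) choose 2) - int N ^ ((m - k - 1) choose 2)"
    proof -
      have "Pow {k + 2..<Suc m} = ?\<R> k \<union> Pow {k + 3..<Suc m}"
        using k2 by (auto simp: subset_iff) (metis Suc_leI add_2_eq_Suc' eval_nat_numeral(3) le_neq_implies_less add_Suc_right)
      then have "(\<Sum>T\<in>Pow {k + 2..<Suc m}. ?e T) = (\<Sum>T\<in>?\<R> k \<union> Pow {k + 3..<Suc m}. ?e T)" by simp
      also have "\<dots> = (\<Sum>T\<in>?\<R> k. ?e T) + (\<Sum>T\<in>Pow {k + 3..<Suc m}. ?e T)"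
        by (rule sum.union_disjoint) auto
      finally have "(\<Sum>T\<in>?\<R> k. ?e T) = (\<Sum>T\<in>Pow {k + 2..<Suc m}. ?e T) - (\<Sum>T\<in>Pow {k + 3..<Suc m}. ?e T)" by simp
      also have "(\<Sum>T\<in>Pow {k + 2..<Suc m}. ?e T) = int N ^ (Suc (Suc m - (k + 2)) choose 2)"
        using k2 assms by (intro tot) auto
      also have "(\<Sum>T\<in>Pow {k + 3..<Suc m}. ?e T) = int N ^ (Suc (Suc m - (k + 3)) choose 2)"
        using k2 assms by (intro tot) auto
      also have "Suc (Suc m - (k + 2)) = m - k" using k2 by simp
      also have "Suc (Suc m - (k + 3)) = m - k - 1" using k2 by simp
      finally show ?thesis .
    qed
    finally show "(\<Sum>(S, T)\<in>?\<C> k \<times> ?\<R> k. ?e (S \<union> T)) =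
      (int N ^ ((m - k) choose 2) - int N ^ ((m - k - 1) choose 2)) * cdim k" by (simp add: mult.commute)
  qed
  finally show ?thesis
    using tot[of 1 "Suc m"] assms by (simp add: atLeastLessThanSuc_atLeastAtMost)
qed

text \<open>Each use of the recursion flips the sign and lowers the index by at least two. The bound
  on \<open>m\<close> ensures that after \<open>J\<close> uses the index is at most 2, where the
  remaining sum is empty.\<close>

lemma cdim_eq_inner_sum:
  assumes "m \<le> 2 * J + 2" "m \<le> n"
  shows "cdim m = (\<Sum>j\<le>J. (- 1) ^ j * inner_sum N j m)"
  using assms
proof (induction J arbitrary: m)
  case 0
  then have "{1..m - 2} = {}" by auto
  then show ?case using cdim_rec[OF 0(2)] by (simp del: atLeastatMost_empty_iff)
next
  case (Suc J)
  let ?w = "\<lambda>k. int N ^ ((m - k) choose 2) - int N ^ ((m - k - 1) choose 2)"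
  have "(\<Sum>j\<le>Suc J. (- 1) ^ j * inner_sum N j m) =
    inner_sum N 0 m + (\<Sum>j\<le>J. (- 1) ^ Suc j * inner_sum N (Suc j) m)"
    by (subst sum.atMost_Suc_shift) simp
  also have "(\<Sum>j\<le>J. (- 1) ^ Suc j * inner_sum N (Suc j) m) =
    - (\<Sum>k = 1..m - 2. ?w k * (\<Sum>j\<le>J. (- 1) ^ j * inner_sum N j k))"
    unfolding inner_sum.simps sum_distrib_left sum_negf[symmetric]
    by (subst sum.swap) (simp add: ac_simps)
  also have "(\<Sum>k = 1..m - 2. ?w k * (\<Sum>j\<le>J. (- 1) ^ j * inner_sum N j k)) = (\<Sum>k = 1..m - 2. ?w k * cdim k)"
    by (intro sum.cong refl arg_cong2[where f = "(*)"] Suc.IH[symmetric]) (use Suc.prems in auto)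
  also have "inner_sum N 0 m + - (\<Sum>k = 1..m - 2. ?w k * cdim k) = cdim m"
    unfolding cdim_rec[OF Suc.prems(2)] by simp
  finally show ?case ..
qed

end

theorem theorem4p3:
  fixes q :: "'a::field_char_0" and qm :: "nat \<Rightarrow> nat \<Rightarrow> 'a" and n N :: nat
  assumes alg_closed: "\<forall>p :: 'a poly. degree p \<ge> 1 \<longrightarrow> (\<exists>x. poly p x = 0)"
    and n: "n \<ge> 1"
    and N: "N \<ge> 2" and qN: "q ^ N = 1" and qord: "\<forall>k. 0 < k \<and> k < N \<longrightarrow> q ^ k \<noteq> 1"
    and diag: "\<forall>i\<in>{1..n}. qm i i = q"
    and adj: "\<forall>i. 1 \<le> i \<and> i < n \<longrightarrow> qm i (i + 1) * qm (i + 1) i = inverse q"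
    and far: "\<forall>i\<in>{1..n}. \<forall>j\<in>{1..n}. (i + 2 \<le> j \<or> j + 2 \<le> i) \<longrightarrow> qm i j * qm j i = 1"
  shows "int (nichols_lie_dim n qm) = dim_formula N n"
proof -
  interpret cartan_A qm q n N
    using N qN qord diag adj far by unfold_locales auto
  \<comment> \<open>This cutoff satisfies \<open>n \<le> 2 * ?J + 2\<close>, as the unrolled
    recursion requires.\<close>
  let ?J = "(n - 1) div 2"
  have "int (nichols_lie_dim n qm) = cdim n"
    by (simp add: nichols_lie_dim_eq cdim_def)
  also have "\<dots> = (\<Sum>j\<le>?J. (- 1) ^ j * inner_sum N j n)"
    by (rule cdim_eq_inner_sum) auto
  also have "\<dots> = inner_sum N 0 n + (\<Sum>j = 1..?J. (- 1) ^ j * inner_sum N j n)"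
    by (simp add: atMost_atLeast0 sum.atLeast_Suc_atMost del: inner_sum.simps(2))
  also have "\<dots> = dim_formula N n" by (simp add: dim_formula_def)
  finally show ?thesis .
qed

end
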